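(* Let $n\ge 1$ and let $L,L',h_0\in\mathbb{R}$ satisfy $$0<L+\tfrac32 h_0\sqrt n<L',\qquad 0<h_0\le 1.$$ Let $v\in C^\infty_c(B_L)$ and let $s\in C^\infty(B_{L'}\setminus\{\mathbf 0\})$ be of the form $$s(\mathbf x)=|\mathbf x|^{\gamma}\,\ell\!\left(|\mathbf x|,\frac{\mathbf x}{|\mathbf x|}\right),$$ where $\gamma>-n$ is real and $\ell\in C^\infty((-L',L')\times\mathbb S^{n-1})$ is bounded. Then there is a constant $C$, depending on $\gamma$, $\ell$ and $v$ but independent of $h$ and $\boldsymbol\alpha$, such that for all $0<h<h_0$ and all $\boldsymbol\alpha\in\mathbb R^n$ with $|\boldsymbol\alpha|_\infty\le 1/2$, $$\left|(\mathcal I-T_h^0)[f]\right|\le C\,h^{\gamma+n},\qquad f(\mathbf x):=s(\mathbf x-h\boldsymbol\alpha)\,v(\mathbf x).$$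
   Context: $|\cdot|$ is the Euclidean norm on $\mathbb R^n$, $|\mathbf x|_\infty=\max_i|x_i|$, $B_r=\{\mathbf x\in\mathbb R^n:|\mathbf x|<r\}$, and $\mathbb S^{n-1}$ is the unit sphere of $\mathbb R^n$. For a function $f$ on $\mathbb R^n$, $\mathcal I[f]:=\int_{\mathbb R^n}f(\mathbf x)\,d\mathbf x$, and the punctured trapezoidal rule is $T_h^0[f]:=h^n\sum_{\mathbf y\in h\mathbb Z^n\setminus\{\mathbf 0\}}f(\mathbf y)$; $(\mathcal I-T_h^0)[f]=\mathcal I[f]-T_h^0[f]$. The functions $v$ and $f$ are extended by zero outside $B_L$. *)

theory Defs
  imports "HOL-Analysis.Analysis"
begin

(* C^k on an open set U: the function is continuous and all iterated directional
   derivatives of order at most k exist (with total differentiability at each order below k)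
   and are continuous.  Only meaningful for open U, where the Frechet derivative is unique. *)
primrec Ck_on :: "nat \<Rightarrow> 'a::euclidean_space set \<Rightarrow> ('a \<Rightarrow> 'b::real_normed_vector) \<Rightarrow> bool"
  where
    "Ck_on 0 U f \<longleftrightarrow> continuous_on U f"
  | "Ck_on (Suc k) U f \<longleftrightarrow>
       (\<forall>x\<in>U. f differentiable (at x)) \<and>
       (\<forall>v. Ck_on k U (\<lambda>x. frechet_derivative f (at x) v))"

definition smooth_on :: "'a::euclidean_space set \<Rightarrow> ('a \<Rightarrow> 'b::real_normed_vector) \<Rightarrow> bool"
  where "smooth_on U f \<longleftrightarrow> (\<forall>k. Ck_on k U f)"

(* Smoothness on a subset X that need not be open, such as an embedded submanifold of the
   ambient space: f is locally the restriction of a smooth function on an ambient open set. *)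
definition smooth_on_subset ::
    "'a::euclidean_space set \<Rightarrow> ('a \<Rightarrow> 'b::real_normed_vector) \<Rightarrow> bool"
  where "smooth_on_subset X f \<longleftrightarrow>
    (\<forall>p\<in>X. \<exists>U g. open U \<and> p \<in> U \<and> smooth_on U g \<and> (\<forall>x\<in>U \<inter> X. g x = f x))"

(* Functions on U that are smooth with compact support in U, extended by zero to the whole
   space. *)
definition smooth_compact_support ::
    "'a::euclidean_space set \<Rightarrow> ('a \<Rightarrow> 'b::real_normed_vector) \<Rightarrow> bool"
  where "smooth_compact_support U f \<longleftrightarrow>
    smooth_on U f \<and> compact (closure {x. f x \<noteq> 0}) \<and> closure {x. f x \<noteq> 0} \<subseteq> U"

definition scaled_integer_lattice :: "real \<Rightarrow> (real ^ 'n) set"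
  where "scaled_integer_lattice h = {h *\<^sub>R z | z. \<forall>i. z $ i \<in> \<int>}"

(* The sum is infinite; it is an honest sum for functions with bounded support, and more
   generally for functions that are summable over the lattice. *)
definition punctured_trapezoidal :: "real \<Rightarrow> (real ^ 'n \<Rightarrow> real) \<Rightarrow> real"
  where "punctured_trapezoidal h f =
    h ^ CARD('n) * (\<Sum>\<^sub>\<infinity>y\<in>scaled_integer_lattice h - {0}. f y)"

end

theory Submission
  imports Defs
begin

text \<open>
  Rescaling produces the power of \<open>h\<close>. Put \<open>x = h y\<close>. Away from \<open>y = \<alpha>\<close> the integrand is
  \<open>h powr \<gamma>\<close> times the kernel
  \<open>K y = norm (y - \<alpha>) powr \<gamma> * l (h norm (y - \<alpha>), direction of y - \<alpha>) * v (h y)\<close>, and both the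
  integral and the trapezoidal sum acquire the factor \<open>h ^ n\<close>. So the theorem says exactly that
  the integral of \<open>K\<close> and its punctured sum over the integer lattice differ by at most a
  constant that does not depend on \<open>h\<close> and \<open>\<alpha>\<close>.

  Uniformity in \<open>h\<close> and \<open>\<alpha>\<close> comes from reading \<open>K y\<close> as a value of one function of three
  arguments, \<open>profile \<gamma> l v (r, w, \<beta>)\<close> at \<open>r = h\<close>, \<open>w = y - \<alpha>\<close>, \<open>\<beta> = h \<alpha>\<close>. It is of class
  \<open>C\<^sup>k\<close> for every \<open>k\<close> where \<open>w \<noteq> 0\<close> and \<open>\<beta>\<close> is small (\<open>Ck_on_profile\<close>), also at \<open>r = 0\<close> because \<open>l\<close> is
  smooth across zero radius, and it is homogeneous of degree \<open>\<gamma>\<close> in \<open>w\<close> when \<open>r\<close> is scaled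
  inversely. Compactness of the unit sphere then bounds its \<open>j\<close>-th directional derivative in \<open>w\<close> by
  a constant times \<open>norm w powr (\<gamma> - j)\<close> (\<open>iter_dirderiv_profile_bound\<close>).

  For the quadrature error of \<open>K\<close>, the finitely many lattice points with all coordinates of modulus
  at most one, and their unit cells, contribute a bounded amount: the removed point \<open>0\<close> is the only
  one that can be arbitrarily close to \<open>\<alpha>\<close>, and \<open>norm u powr \<gamma>\<close> is integrable at the origin as \<open>\<gamma> > - n\<close>.
  For the other points, let \<open>S a\<close> be the sum of \<open>K (z + a)\<close> over them. The integral of
  \<open>K\<close> over their cells is the mean of \<open>S\<close> over the unit cube, while the trapezoidal sum is \<open>S 0\<close>,
  so a bound on the oscillation of \<open>S\<close> suffices (\<open>far_sum_oscillation\<close>). Along a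
  coordinate axis \<open>S\<close> and its derivatives are periodic up to boundedly many terms, which are bounded;
  by the mean value theorem every derivative of order
  \<open>j \<ge> 1\<close> therefore has a point where it is bounded, and is bounded everywhere once the next
  derivative is. The induction starts at an order \<open>k \<ge> \<gamma> + 2 n\<close>, for which the lattice sum of
  the decay bound \<open>norm w powr (\<gamma> - k)\<close> converges.
\<close>

section \<open>Calculus of functions of finite differentiability class\<close>

text \<open>
  The definition of \<open>Ck_on\<close> speaks about \<open>frechet_derivative\<close>, a choice that depends on all values
  of the function near the point; on an open set only the values there matter.
\<close>

lemma Ck_on_cong:
  assumes "open U" "\<And>x. x \<in> U \<Longrightarrow> f x = g x"
  shows "Ck_on k U f \<longleftrightarrow> Ck_on k U g"
  using assms(2)
proof (induction k arbitrary: f g)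
  case 0
  then show ?case by (simp cong: continuous_on_cong)
next
  case (Suc k)
  have hd: "(f has_derivative D) (at x) \<longleftrightarrow> (g has_derivative D) (at x)" if "x \<in> U" for x D
  proof
    show "(g has_derivative D) (at x)" if "(f has_derivative D) (at x)"
      using that assms(1) \<open>x \<in> U\<close> Suc.prems by (rule has_derivative_transform_within_open)
    show "(f has_derivative D) (at x)" if "(g has_derivative D) (at x)"
      using that assms(1) \<open>x \<in> U\<close> Suc.prems[symmetric] by (rule has_derivative_transform_within_open)
  qed
  then have "f differentiable at x \<longleftrightarrow> g differentiable at x" if "x \<in> U" for x
    using that by (simp add: differentiable_def)
  moreover have "frechet_derivative f (at x) = frechet_derivative g (at x)" if "x \<in> U" for x
    using hd[OF that] by (simp add: frechet_derivative_def)
  then have "Ck_on k U (\<lambda>x. frechet_derivative f (at x) v)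
      = Ck_on k U (\<lambda>x. frechet_derivative g (at x) v)" for v
    by (intro Suc.IH) simp
  ultimately show ?case by simp
qed

text \<open>
  Any explicit derivative may be used in place of \<open>frechet_derivative\<close>.
\<close>

lemma Ck_on_Suc_I:
  assumes U: "open U" and D: "\<And>x. x \<in> U \<Longrightarrow> (f has_derivative D x) (at x)"
    and "\<And>v. Ck_on k U (\<lambda>x. D x v)"
  shows "Ck_on (Suc k) U f"
proof -
  have "frechet_derivative f (at x) = D x" if "x \<in> U" for x
    using frechet_derivative_at[OF D[OF that]] by simp
  then have "Ck_on k U (\<lambda>x. frechet_derivative f (at x) v)" for v
    using assms(3)[of v] Ck_on_cong[OF U, of "\<lambda>x. frechet_derivative f (at x) v" "\<lambda>x. D x v"] by simp
  then show ?thesis using D by (auto simp: differentiable_def)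
qed

lemma Ck_on_has_derivative:
  assumes "Ck_on (Suc k) U f" "x \<in> U"
  shows "(f has_derivative frechet_derivative f (at x)) (at x)"
  using assms by (simp add: frechet_derivative_works)

lemma Ck_on_continuous: "Ck_on k U f \<Longrightarrow> continuous_on U f"
  by (cases k) (auto intro!: continuous_at_imp_continuous_on differentiable_imp_continuous_within)

lemma Ck_on_lower: "Ck_on (Suc k) U f \<Longrightarrow> Ck_on k U f"
proof (induction k arbitrary: f)
  case 0
  then show ?case using Ck_on_continuous[OF 0] by simp
next
  case (Suc k)
  then show ?case by (auto simp: Suc.IH)
qed

lemma Ck_on_mono:
  assumes "Ck_on k U f" "j \<le> k"
  shows "Ck_on j U f"
  using assms(2)
proof (induction rule: inc_induct)
  case (step i)
  show ?case by (rule Ck_on_lower[OF step.IH])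
qed (rule assms(1))

lemma Ck_on_local:
  assumes "\<And>x. x \<in> U \<Longrightarrow> \<exists>V. open V \<and> x \<in> V \<and> Ck_on k V f"
  shows "Ck_on k U f"
  using assms
proof (induction k arbitrary: f)
  case 0
  show ?case
    unfolding Ck_on.simps
  proof (rule continuous_at_imp_continuous_on, rule ballI)
    fix x assume "x \<in> U"
    then obtain V where "open V" "x \<in> V" "continuous_on V f" using 0 by auto
    then show "isCont f x" by (simp add: continuous_on_eq_continuous_at)
  qed
next
  case (Suc k)
  have "f differentiable at x" if "x \<in> U" for x
    using Suc.prems[OF that] unfolding Ck_on.simps by blast
  moreover have "Ck_on k U (\<lambda>x. frechet_derivative f (at x) v)" for v
  proof (rule Suc.IH)
    fix x assume "x \<in> U"
    then obtain V where "open V" "x \<in> V" "Ck_on (Suc k) V f" using Suc.prems by blast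
    then show "\<exists>V. open V \<and> x \<in> V \<and> Ck_on k V (\<lambda>x. frechet_derivative f (at x) v)"
      by (intro exI[of _ V]) simp
  qed
  ultimately show ?case by simp
qed

lemma Ck_on_linear:
  assumes U: "open U" and T: "bounded_linear T" and f: "Ck_on k U f"
  shows "Ck_on k U (\<lambda>x. T (f x))"
  using f
proof (induction k arbitrary: f)
  case 0
  then show ?case using T by (auto intro: bounded_linear.continuous_on)
next
  case (Suc k)
  show ?case
  proof (rule Ck_on_Suc_I[OF U, where D = "\<lambda>x v. T (frechet_derivative f (at x) v)"])
    show "((\<lambda>x. T (f x)) has_derivative (\<lambda>v. T (frechet_derivative f (at x) v))) (at x)"
      if "x \<in> U" for x
      using bounded_linear.has_derivative[OF T Ck_on_has_derivative[OF Suc.prems that]] .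
    show "Ck_on k U (\<lambda>x. T (frechet_derivative f (at x) v))" for v
      using Suc.prems by (intro Suc.IH) simp
  qed
qed

lemma Ck_on_const: assumes U: "open U" shows "Ck_on k U (\<lambda>x. c)"
proof (induction k arbitrary: c)
  case (Suc k)
  show ?case by (rule Ck_on_Suc_I[OF U, where D = "\<lambda>x v. 0"]) (auto intro: Suc)
qed simp

lemma Ck_on_bounded_linear: 
  assumes U: "open U" and T: "bounded_linear T" shows "Ck_on k U T"
proof -
  have "Ck_on k U (\<lambda>x. x)"
  proof (cases k)
    case (Suc m)
    show ?thesis unfolding Suc
      by (rule Ck_on_Suc_I[OF U, where D = "\<lambda>x v. v"]) (auto intro: Ck_on_const U)
  qed simp
  from Ck_on_linear[OF U T this] show ?thesis .
qed

lemma Ck_on_add: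
  assumes U: "open U" and "Ck_on k U f" "Ck_on k U g"
  shows "Ck_on k U (\<lambda>x. f x + g x)"
  using assms(2,3)
proof (induction k arbitrary: f g)
  case 0
  then show ?case by (auto intro: continuous_intros)
next
  case (Suc k)
  show ?case
  proof (rule Ck_on_Suc_I[OF U, where D = "\<lambda>x v. frechet_derivative f (at x) v + frechet_derivative g (at x) v"])
    show "((\<lambda>x. f x + g x) has_derivative (\<lambda>v. frechet_derivative f (at x) v + frechet_derivative g (at x) v)) (at x)"
      if "x \<in> U" for x
      using Ck_on_has_derivative[OF Suc.prems(1) that] Ck_on_has_derivative[OF Suc.prems(2) that]
      by (rule has_derivative_add)
    show "Ck_on k U (\<lambda>x. frechet_derivative f (at x) v + frechet_derivative g (at x) v)" for v
      using Suc.prems by (intro Suc.IH) auto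
  qed
qed

lemma Ck_on_sum:
  assumes U: "open U" and "finite I" "\<And>i. i \<in> I \<Longrightarrow> Ck_on k U (f i)"
  shows "Ck_on k U (\<lambda>x. \<Sum>i\<in>I. f i x)"
  using assms(2,3) by (induction I rule: finite_induct) (auto intro: Ck_on_const Ck_on_add U)

lemma Ck_on_bilinear:
  assumes U: "open U" and P: "bounded_bilinear P" and "Ck_on k U f" "Ck_on k U g"
  shows "Ck_on k U (\<lambda>x. P (f x) (g x))"
  using assms(3,4)
proof (induction k arbitrary: f g)
  case 0
  then show ?case using P by (auto intro: bounded_bilinear.continuous_on)
next
  case (Suc k)
  show ?case
  proof (rule Ck_on_Suc_I[OF U, where D = "\<lambda>x v. P (f x) (frechet_derivative g (at x) v) + P (frechet_derivative f (at x) v) (g x)"])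
    show "((\<lambda>x. P (f x) (g x)) has_derivative (\<lambda>v. P (f x) (frechet_derivative g (at x) v) + P (frechet_derivative f (at x) v) (g x))) (at x)"
      if "x \<in> U" for x
      using bounded_bilinear.FDERIV[OF P Ck_on_has_derivative[OF Suc.prems(1) that] Ck_on_has_derivative[OF Suc.prems(2) that]] .
    show "Ck_on k U (\<lambda>x. P (f x) (frechet_derivative g (at x) v) + P (frechet_derivative f (at x) v) (g x))" for v
      using Suc.prems Ck_on_lower[OF Suc.prems(1)] Ck_on_lower[OF Suc.prems(2)]
      by (intro Ck_on_add[OF U] Suc.IH) simp_all
  qed
qed

text \<open>
  The directional derivative of a composition involves the derivative of the outer function in a
  direction that varies with the point. Expanding this direction in the standard basis turns it
  into a sum of products of functions of class \<open>C\<^sup>k\<close>, to which the induction hypothesis applies.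
\<close>

lemma Ck_on_compose:
  fixes m :: "'a::euclidean_space \<Rightarrow> 'b::euclidean_space"
    and g :: "'b \<Rightarrow> 'c::real_normed_vector"
  assumes U: "open U" and "Ck_on k U m" "Ck_on k T g" and sub: "m ` U \<subseteq> T"
  shows "Ck_on k U (\<lambda>x. g (m x))"
  using assms(2,3)
proof (induction k arbitrary: g)
  case 0
  then show ?case using sub by (auto intro: continuous_on_compose2)
next
  case (Suc k)
  let ?D = "\<lambda>x v. \<Sum>b\<in>Basis. (frechet_derivative m (at x) v \<bullet> b) *\<^sub>R frechet_derivative g (at (m x)) b"
  show ?case
  proof (rule Ck_on_Suc_I[OF U, where D = ?D])
    show "((\<lambda>x. g (m x)) has_derivative ?D x) (at x)" if x: "x \<in> U" for x
    proof -
      have mx: "m x \<in> T" using sub x by auto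
      note dg = Ck_on_has_derivative[OF Suc.prems(2) mx]
      have eq: "frechet_derivative g (at (m x)) w = (\<Sum>b\<in>Basis. (w \<bullet> b) *\<^sub>R frechet_derivative g (at (m x)) b)" for w
      proof -
        interpret bounded_linear "frechet_derivative g (at (m x))"
          using dg by (rule has_derivative_bounded_linear)
        show ?thesis
          by (subst euclidean_representation[of w, symmetric]) (simp only: sum scaleR)
      qed
      show ?thesis
        using has_derivative_compose[OF Ck_on_has_derivative[OF Suc.prems(1) x] dg]
        by (rule has_derivative_eq_rhs) (rule ext, rule eq)
    qed
    fix v
    have m': "Ck_on k U (\<lambda>x. frechet_derivative m (at x) v)" using Suc.prems by simp
    have g': "Ck_on k T (\<lambda>y. frechet_derivative g (at y) b)" for b
      using Suc.prems(2) by simp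
    show "Ck_on k U (\<lambda>x. ?D x v)"
      by (intro Ck_on_sum[OF U finite_Basis] Ck_on_bilinear[OF U bounded_bilinear_scaleR]
          Ck_on_linear[OF U bounded_linear_inner_left m'] Suc.IH[OF Ck_on_lower[OF Suc.prems(1)] g'])
  qed
qed

lemma Ck_on_powr: "Ck_on k {0<..} (\<lambda>t::real. t powr a)"
proof (induction k arbitrary: a)
  case 0
  show ?case by (auto intro!: continuous_intros)
next
  case (Suc k)
  have U: "open {0::real<..}" by simp
  show ?case
  proof (rule Ck_on_Suc_I[OF U, where D = "\<lambda>x v. a * x powr (a - 1) * v"])
    show "((\<lambda>t. t powr a) has_derivative (\<lambda>v. a * x powr (a - 1) * v)) (at x)"
      if "x \<in> {0<..}" for x :: real
      using has_real_derivative_powr[of x a] that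
      unfolding has_field_derivative_def by simp
    show "Ck_on k {0<..} (\<lambda>x. a * x powr (a - 1) * v)" for v
      by (intro Ck_on_bilinear[OF U bounded_bilinear_mult] Ck_on_const[OF U] Suc.IH)
  qed
qed

lemma Ck_on_Pair:
  assumes U: "open U" and "Ck_on k U f" "Ck_on k U g"
  shows "Ck_on k U (\<lambda>x. (f x, g x))"
proof -
  have l1: "bounded_linear (\<lambda>y. (y, 0))" and l2: "bounded_linear (\<lambda>z. (0, z))"
    by (auto intro!: bounded_linear_Pair bounded_linear_ident bounded_linear_zero)
  have "Ck_on k U (\<lambda>x. (f x, 0) + (0, g x))"
    by (intro Ck_on_add[OF U] Ck_on_linear[OF U l1] Ck_on_linear[OF U l2] assms)
  then show ?thesis by simp
qed

section \<open>The rescaled integrand\<close>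

primrec iter_dirderiv :: "'a::euclidean_space \<Rightarrow> nat \<Rightarrow> ('a \<Rightarrow> 'b::real_normed_vector) \<Rightarrow> 'a \<Rightarrow> 'b"
  where
    "iter_dirderiv c 0 f = f"
  | "iter_dirderiv c (Suc j) f = (\<lambda>x. frechet_derivative (iter_dirderiv c j f) (at x) c)"

lemma Ck_on_iter_dirderiv:
  "Ck_on (j + k) U f \<Longrightarrow> Ck_on k U (iter_dirderiv c j f)"
proof (induction j arbitrary: k)
  case (Suc j)
  have "Ck_on (Suc k) U (iter_dirderiv c j f)" using Suc.IH[of "Suc k"] Suc.prems by simp
  then show ?case by simp
qed simp

text \<open>
  All mean value arguments below take place on lines, where iterated directional derivatives are
  ordinary derivatives.
\<close>

lemma iter_dirderiv_line:
  fixes f :: "'a::euclidean_space \<Rightarrow> real"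
  assumes "Ck_on k U f" "j < k" "y + t *\<^sub>R c \<in> U"
  shows "((\<lambda>t. iter_dirderiv c j f (y + t *\<^sub>R c)) has_real_derivative
    iter_dirderiv c (Suc j) f (y + t *\<^sub>R c)) (at t)"
proof -
  have "Ck_on (Suc 0) U (iter_dirderiv c j f)"
    by (rule Ck_on_iter_dirderiv, rule Ck_on_mono[OF assms(1)]) (use assms(2) in simp)
  note d = Ck_on_has_derivative[OF this assms(3)]
  have "((\<lambda>t. y + t *\<^sub>R c) has_derivative (\<lambda>h. h *\<^sub>R c)) (at t)"
    by (auto intro!: derivative_eq_intros)
  from has_derivative_compose[OF this d]
  have "((\<lambda>t. iter_dirderiv c j f (y + t *\<^sub>R c)) has_derivative
      (\<lambda>h. frechet_derivative (iter_dirderiv c j f) (at (y + t *\<^sub>R c)) (h *\<^sub>R c))) (at t)" .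
  moreover have "frechet_derivative (iter_dirderiv c j f) (at (y + t *\<^sub>R c)) (h *\<^sub>R c)
      = iter_dirderiv c (Suc j) f (y + t *\<^sub>R c) * h" for h
    using linear_scale[OF has_derivative_linear[OF d], of h c] by simp
  ultimately show ?thesis by (simp add: has_field_derivative_def)
qed

lemma iter_dirderiv_eq_0:
  assumes "open U" "\<And>x. x \<in> U \<Longrightarrow> f x = 0" "x \<in> U"
  shows "iter_dirderiv c j f x = 0"
  using assms(3)
proof (induction j arbitrary: x)
  case (Suc j)
  have "(iter_dirderiv c j f has_derivative (\<lambda>h. 0)) (at x)"
    by (rule has_derivative_transform_within_open[OF has_derivative_const[of 0] \<open>open U\<close> Suc.prems])
      (simp add: Suc.IH)
  from frechet_derivative_at[OF this] show ?case by (simp add: fun_eq_iff)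
qed (use assms in auto)

text \<open>
  Every point outside the ball has a neighbourhood on which the function vanishes, as the support
  is closed and contained in the ball.
\<close>

lemma Ck_on_smooth_compact_support:
  fixes v :: "'a::euclidean_space \<Rightarrow> real"
  assumes "smooth_compact_support (ball 0 L) v"
  shows "Ck_on k UNIV v"
proof (rule Ck_on_local)
  fix x :: 'a
  show "\<exists>V. open V \<and> x \<in> V \<and> Ck_on k V v"
  proof (cases "x \<in> ball 0 L")
    case True
    then show ?thesis
      using assms by (auto simp: smooth_compact_support_def smooth_on_def intro!: exI[of _ "ball 0 L"])
  next
    case False
    let ?V = "- closure {x. v x \<noteq> 0}"
    have V: "open ?V" by (intro open_Compl closed_closure)
    have "v y = 0" if "y \<in> ?V" for y
      using that subsetD[OF closure_subset, of y "{x. v x \<noteq> 0}"] by blast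
    then have "Ck_on k ?V v"
      by (intro iffD2[OF Ck_on_cong[OF V] Ck_on_const[OF V]])
    moreover have "x \<in> ?V" using False assms unfolding smooth_compact_support_def by blast
    ultimately show ?thesis using V by blast
  qed
qed

lemma smooth_compact_support_eq_0:
  assumes "smooth_compact_support (ball 0 L) v" "norm x \<ge> L"
  shows "v x = 0"
proof (rule ccontr)
  assume "v x \<noteq> 0"
  then have "x \<in> closure {x. v x \<noteq> 0}" by (intro subsetD[OF closure_subset]) simp
  then have "x \<in> ball 0 L" using assms(1) unfolding smooth_compact_support_def by blast
  then show False using assms(2) by simp
qed

text \<open>
  The integrand at the point \<open>r *\<^sub>R w + \<beta>\<close>, divided by \<open>r powr \<gamma>\<close>; the formula extends it across
  \<open>r = 0\<close>, so that \<open>r\<close> can range over a compact interval. The shift \<open>\<beta>\<close> is an independent argument so that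
  compactness covers all admissible shifts at once.
\<close>

definition profile :: "real \<Rightarrow> (real \<times> 'a \<Rightarrow> real) \<Rightarrow> ('a \<Rightarrow> real) \<Rightarrow> real \<times> 'a \<times> 'a::euclidean_space \<Rightarrow> real"
  where "profile \<gamma> l v = (\<lambda>(r, w, \<beta>). norm w powr \<gamma> * l (r * norm w, w /\<^sub>R norm w) * v (r *\<^sub>R w + \<beta>))"

definition profile_domain :: "real \<Rightarrow> (real \<times> 'a \<times> 'a::euclidean_space) set"
  where "profile_domain B = {(r, w, \<beta>). w \<noteq> 0 \<and> norm \<beta> < B}"

lemma open_profile_domain: "open (profile_domain B)"
  unfolding profile_domain_def case_prod_beta
  by (auto intro!: open_Collect_conj open_Collect_neq open_Collect_less continuous_intros)

text \<open>
  The norm is the square root of an inner product, and real powers are smooth on the positive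
  half-line.
\<close>

lemma Ck_on_norm_powr:
  fixes w :: "'b::euclidean_space \<Rightarrow> 'a::euclidean_space"
  assumes U: "open U" and w: "Ck_on k U w" and nz: "\<And>x. x \<in> U \<Longrightarrow> w x \<noteq> 0"
  shows "Ck_on k U (\<lambda>x. norm (w x) powr a)"
proof -
  have "Ck_on k U (\<lambda>x. (w x \<bullet> w x) powr (a / 2))"
    using nz by (intro Ck_on_compose[OF U _ Ck_on_powr] Ck_on_bilinear[OF U bounded_bilinear_inner] w) auto
  moreover have "(w x \<bullet> w x) powr (a / 2) = norm (w x) powr a" for x
  proof (cases "w x = 0")
    case False
    have "(w x \<bullet> w x) powr (a / 2) = (norm (w x) powr 2) powr (a / 2)"
      using False by (simp add: power2_norm_eq_inner)
    then show ?thesis by (simp only: powr_powr) simp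
  qed simp
  ultimately show ?thesis by simp
qed

lemma profile_eq_0:
  assumes "smooth_compact_support (ball 0 L) v" "norm (r *\<^sub>R w + \<beta>) \<ge> L"
  shows "profile \<gamma> l v (r, w, \<beta>) = 0"
  using smooth_compact_support_eq_0[OF assms] by (simp add: profile_def)

text \<open>
  The profile contains \<open>l\<close> at radius \<open>r * norm w\<close>, where \<open>l\<close> is smooth only if the modulus of this
  radius is less than \<open>L'\<close>. If it is not, the argument \<open>r w + \<beta>\<close> of \<open>v\<close> has norm greater than \<open>L\<close>
  by \<open>L + B \<le> L'\<close>, and the profile vanishes nearby.
\<close>

lemma Ck_on_profile:
  fixes v :: "'a::euclidean_space \<Rightarrow> real"
  assumes v: "smooth_compact_support (ball 0 L) v"
    and l: "smooth_on_subset ({-L'<..<L'} \<times> sphere 0 1) l"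
    and LB: "L + B \<le> L'"
  shows "Ck_on k (profile_domain B) (profile \<gamma> l v)"
proof (rule Ck_on_local)
  fix p :: "real \<times> 'a \<times> 'a"
  assume pD: "p \<in> profile_domain B"
  let ?W = "profile_domain B :: (real \<times> 'a \<times> 'a) set"
  obtain r0 w0 b0 where p: "p = (r0, w0, b0)" by (cases p)
  have w0: "w0 \<noteq> 0" and b0: "norm b0 < B" using pD by (auto simp: p profile_domain_def)
  have bl: "bounded_linear (\<lambda>q::real\<times>'a\<times>'a. fst q)" "bounded_linear (\<lambda>q::real\<times>'a\<times>'a. fst (snd q))"
    "bounded_linear (\<lambda>q::real\<times>'a\<times>'a. snd (snd q))"
    by (auto intro!: bounded_linear_intros)
  show "\<exists>V. open V \<and> p \<in> V \<and> Ck_on k V (profile \<gamma> l v)"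
  proof (cases "\<bar>r0\<bar> * norm w0 < L'")
    case True
    define m :: "real \<times> 'a \<times> 'a \<Rightarrow> real \<times> 'a" where "m q = (fst q * norm (fst (snd q)), fst (snd q) /\<^sub>R norm (fst (snd q)))" for q
    have "m p \<in> {-L'<..<L'} \<times> sphere 0 1"
    proof -
      have "\<bar>r0 * norm w0\<bar> < L'" using True by (simp add: abs_mult)
      then show ?thesis using w0 by (auto simp: m_def p abs_less_iff)
    qed
    from bspec[OF l[unfolded smooth_on_subset_def] this]
    obtain U g where "open U \<and> m p \<in> U \<and> smooth_on U g \<and> (\<forall>x\<in>U \<inter> {-L'<..<L'} \<times> sphere 0 1. g x = l x)"
      by (elim exE)
    then have U: "open U" "m p \<in> U" "smooth_on U g"
      and g: "\<And>x. x \<in> U \<inter> {-L'<..<L'} \<times> sphere 0 1 \<Longrightarrow> g x = l x"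
      by simp_all
    have cm: "continuous_on ?W m"
      unfolding m_def by (auto intro!: continuous_intros simp: profile_domain_def)
    define W0 where "W0 = ?W \<inter> {q. \<bar>fst q\<bar> * norm (fst (snd q)) < L'}"
    have oW0: "open W0"
      unfolding W0_def by (intro open_Int open_profile_domain open_Collect_less continuous_intros)
    define V where "V = W0 \<inter> m -` U"
    have V: "open V"
      unfolding V_def using cm oW0 U(1) continuous_on_open_vimage[OF oW0, of m]
      by (simp add: W0_def Int_commute continuous_on_subset)
    have pV: "p \<in> V" using pD True U(2) by (simp add: V_def W0_def p)
    have nz: "fst (snd q) \<noteq> 0" if "q \<in> V" for q
      using that by (auto simp: V_def W0_def profile_domain_def)
    note c = Ck_on_bounded_linear[OF V bl(1)] Ck_on_bounded_linear[OF V bl(2)] Ck_on_bounded_linear[OF V bl(3)]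
    note b = Ck_on_norm_powr[OF V c(2) nz]
    have ckm: "Ck_on k V m"
    proof -
      have "Ck_on k V (\<lambda>q. (fst q * norm (fst (snd q)) powr 1, (norm (fst (snd q)) powr (-1)) *\<^sub>R fst (snd q)))"
        by (intro Ck_on_Pair[OF V] Ck_on_bilinear[OF V bounded_bilinear_mult]
            Ck_on_bilinear[OF V bounded_bilinear_scaleR] b c) auto
      moreover have "m q = (fst q * norm (fst (snd q)) powr 1, (norm (fst (snd q)) powr (-1)) *\<^sub>R fst (snd q))" for q
        by (simp add: m_def powr_minus)
      ultimately show ?thesis by presburger
    qed
    have "Ck_on k V (\<lambda>q. g (m q))"
      using U(3) by (intro Ck_on_compose[OF V ckm, of U]) (auto simp: smooth_on_def V_def)
    moreover have "Ck_on k V (\<lambda>q. v (fst q *\<^sub>R fst (snd q) + snd (snd q)))"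
      by (rule Ck_on_compose[OF V _ Ck_on_smooth_compact_support[OF v]])
        (intro Ck_on_add[OF V] Ck_on_bilinear[OF V bounded_bilinear_scaleR] c, simp)
    ultimately have C: "Ck_on k V (\<lambda>q. norm (fst (snd q)) powr \<gamma> * g (m q) * v (fst q *\<^sub>R fst (snd q) + snd (snd q)))"
      by (intro Ck_on_bilinear[OF V bounded_bilinear_mult] b) auto
    have eq: "norm (fst (snd q)) powr \<gamma> * g (m q) * v (fst q *\<^sub>R fst (snd q) + snd (snd q)) = profile \<gamma> l v q"
      if "q \<in> V" for q
    proof -
      obtain r w \<beta> where q: "q = (r, w, \<beta>)" by (cases q)
      have "m q \<in> {-L'<..<L'} \<times> sphere 0 1"
      proof -
        have "\<bar>r * norm w\<bar> < L'" using that by (simp add: abs_mult V_def W0_def q)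
        then show ?thesis using nz[OF that] by (auto simp: m_def q abs_less_iff)
      qed
      then have "g (m q) = l (m q)" using that by (intro g) (auto simp: V_def)
      then show ?thesis by (simp add: q m_def profile_def)
    qed
    have "Ck_on k V (profile \<gamma> l v)"
      by (rule iffD2[OF Ck_on_cong[OF V] C]) (rule eq[symmetric])
    then show ?thesis using V pV by blast
  next
    case False
    define V where "V = {q :: real \<times> 'a \<times> 'a. norm (fst q *\<^sub>R fst (snd q) + snd (snd q)) > L}"
    have V: "open V" unfolding V_def by (intro open_Collect_less continuous_intros)
    have "norm (r0 *\<^sub>R w0) - norm b0 \<le> norm (r0 *\<^sub>R w0 + b0)"
      using norm_triangle_ineq2[of "r0 *\<^sub>R w0" "- b0"] by simp
    then have "p \<in> V" using False b0 LB by (simp add: V_def p)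
    moreover have "profile \<gamma> l v q = 0" if "q \<in> V" for q
      using that profile_eq_0[OF v, of "fst q" "fst (snd q)" "snd (snd q)"] by (simp add: V_def)
    then have "Ck_on k V (profile \<gamma> l v)"
      by (intro iffD2[OF Ck_on_cong[OF V] Ck_on_const[OF V]])
    ultimately show ?thesis using V by blast
  qed
qed

text \<open>
  The radius \<open>r * norm u\<close>, the direction of \<open>u\<close> and the product \<open>r u\<close> do not change when \<open>u\<close> is
  divided by \<open>\<rho>\<close> and \<open>r\<close> is multiplied by it.
\<close>

lemma profile_scale:
  fixes u :: "'a::euclidean_space"
  assumes "\<rho> > 0"
  shows "profile \<gamma> l v (r, u, \<beta>) = \<rho> powr \<gamma> * profile \<gamma> l v (r * \<rho>, u /\<^sub>R \<rho>, \<beta>)"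
proof -
  have "norm u powr \<gamma> = \<rho> powr \<gamma> * norm (u /\<^sub>R \<rho>) powr \<gamma>"
    using assms by (simp add: powr_mult[symmetric] mult.assoc[symmetric])
  moreover have "r * \<rho> * norm (u /\<^sub>R \<rho>) = r * norm u"
    "(u /\<^sub>R \<rho>) /\<^sub>R norm (u /\<^sub>R \<rho>) = u /\<^sub>R norm u"
    "(r * \<rho>) *\<^sub>R (u /\<^sub>R \<rho>) = r *\<^sub>R u"
    using assms by simp_all
  ultimately show ?thesis by (simp only: profile_def prod.case mult.assoc)
qed

text \<open>
  Each differentiation in \<open>w\<close> of the homogeneity relation lowers the degree by one.
\<close>

lemma iter_dirderiv_profile_scale:
  fixes u b :: "'a::euclidean_space"
  assumes H: "Ck_on k (profile_domain B) (profile \<gamma> l v)" and "j \<le> k" and \<rho>: "\<rho> > 0"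
    and \<beta>: "norm \<beta> < B" and "u \<noteq> 0"
  shows "iter_dirderiv (0, b, 0) j (profile \<gamma> l v) (r, u, \<beta>) =
    \<rho> powr (\<gamma> - real j) * iter_dirderiv (0, b, 0) j (profile \<gamma> l v) (r * \<rho>, u /\<^sub>R \<rho>, \<beta>)"
  using assms(2,5)
proof (induction j arbitrary: u)
  case 0
  then show ?case using profile_scale[OF \<rho>] by simp
next
  case (Suc j)
  let ?D = "iter_dirderiv (0, b, 0 :: 'a) j (profile \<gamma> l v)"
  let ?D' = "iter_dirderiv (0, b, 0 :: 'a) (Suc j) (profile \<gamma> l v)"
  let ?c = "(0, b, 0) :: real \<times> 'a \<times> 'a"
  let ?S = "{t. u + t *\<^sub>R b \<noteq> 0}"
  have S: "open ?S" by (intro open_Collect_neq continuous_intros)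
  have "((\<lambda>t. ?D ((r, u, \<beta>) + t *\<^sub>R ?c)) has_real_derivative ?D' ((r, u, \<beta>) + 0 *\<^sub>R ?c)) (at 0)"
    by (rule iter_dirderiv_line[OF H]) (use Suc.prems \<beta> in \<open>auto simp: profile_domain_def\<close>)
  then have 1: "((\<lambda>t. ?D (r, u + t *\<^sub>R b, \<beta>)) has_real_derivative ?D' (r, u, \<beta>)) (at 0)"
    by simp
  have 2: "((\<lambda>t. ?D ((r * \<rho>, u /\<^sub>R \<rho>, \<beta>) + t *\<^sub>R ?c)) has_real_derivative
      ?D' ((r * \<rho>, u /\<^sub>R \<rho>, \<beta>) + (0 / \<rho>) *\<^sub>R ?c)) (at (0 / \<rho>))"
    by (rule iter_dirderiv_line[OF H]) (use Suc.prems \<beta> \<rho> in \<open>auto simp: profile_domain_def\<close>)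
  have "((\<lambda>t. t / \<rho>) has_real_derivative 1 / \<rho>) (at 0)"
    using \<rho> by (auto intro!: derivative_eq_intros)
  from DERIV_cmult[OF DERIV_chain2[OF 2 this], of "\<rho> powr (\<gamma> - real j)"]
  have "((\<lambda>t. \<rho> powr (\<gamma> - real j) * ?D (r * \<rho>, (u + t *\<^sub>R b) /\<^sub>R \<rho>, \<beta>)) has_real_derivative
      \<rho> powr (\<gamma> - real j) * (?D' (r * \<rho>, u /\<^sub>R \<rho>, \<beta>) * (1 / \<rho>))) (at 0)"
    by (simp add: scaleR_add_right divide_inverse mult.commute)
  note D = this
  have eq: "\<rho> powr (\<gamma> - real j) * ?D (r * \<rho>, (u + t *\<^sub>R b) /\<^sub>R \<rho>, \<beta>) = ?D (r, u + t *\<^sub>R b, \<beta>)"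
    if "t \<in> ?S" for t
    using Suc.IH[of "u + t *\<^sub>R b"] Suc.prems that by simp
  from has_field_derivative_transform_within_open[OF D S _ eq] Suc.prems
  have "((\<lambda>t. ?D (r, u + t *\<^sub>R b, \<beta>)) has_real_derivative
      \<rho> powr (\<gamma> - real j) * (?D' (r * \<rho>, u /\<^sub>R \<rho>, \<beta>) * (1 / \<rho>))) (at 0)"
    by simp
  from DERIV_unique[OF 1 this]
  have "?D' (r, u, \<beta>) = \<rho> powr (\<gamma> - real j) * (?D' (r * \<rho>, u /\<^sub>R \<rho>, \<beta>) * (1 / \<rho>))" .
  also have "\<dots> = \<rho> powr (\<gamma> - real (Suc j)) * ?D' (r * \<rho>, u /\<^sub>R \<rho>, \<beta>)"
  proof -
    have "\<rho> powr (\<gamma> - real (Suc j)) = \<rho> powr (\<gamma> - real j) / \<rho>"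
      using \<rho> powr_diff[of \<rho> "\<gamma> - real j" 1] by (simp add: algebra_simps)
    then show ?thesis by simp
  qed
  finally show ?case .
qed

lemma iter_dirderiv_profile_eq_0:
  fixes v :: "'a::euclidean_space \<Rightarrow> real"
  assumes v: "smooth_compact_support (ball 0 L) v" and "norm (r *\<^sub>R w + \<beta>) > L"
  shows "iter_dirderiv c j (profile \<gamma> l v) (r, w, \<beta>) = 0"
proof (rule iter_dirderiv_eq_0)
  show "open {q :: real \<times> 'a \<times> 'a. norm (fst q *\<^sub>R fst (snd q) + snd (snd q)) > L}"
    by (intro open_Collect_less continuous_intros)
  show "profile \<gamma> l v q = 0" if "q \<in> {q. norm (fst q *\<^sub>R fst (snd q) + snd (snd q)) > L}" for q
    using that profile_eq_0[OF v, of "fst q" "fst (snd q)" "snd (snd q)"] by simp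
qed (use assms in simp)

text \<open>
  Homogeneity with \<open>\<rho> = norm u\<close> moves \<open>u\<close> to the unit sphere. The remaining parameters range over
  a compact set, since the derivatives vanish when \<open>r * norm u > L'\<close>. This is where the constant
  becomes uniform in \<open>h\<close> and \<open>\<alpha>\<close>.
\<close>

lemma iter_dirderiv_profile_bound:
  fixes v :: "'a::euclidean_space \<Rightarrow> real"
  assumes v: "smooth_compact_support (ball 0 L) v"
    and l: "smooth_on_subset ({-L'<..<L'} \<times> sphere 0 1) l"
    and LB: "L + B \<le> L'" and B': "B' < B"
  shows "\<exists>C>0. \<forall>j\<le>k. \<forall>b\<in>Basis. \<forall>r\<ge>0. \<forall>u \<beta>. u \<noteq> 0 \<longrightarrow> norm \<beta> \<le> B' \<longrightarrow>
    \<bar>iter_dirderiv (0, b, 0) j (profile \<gamma> l v) (r, u, \<beta>)\<bar> \<le> C * norm u powr (\<gamma> - real j)"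
proof -
  note H = Ck_on_profile[OF v l LB, of _ \<gamma>]
  have "\<exists>C. \<forall>r\<ge>0. \<forall>u \<beta>. u \<noteq> 0 \<longrightarrow> norm \<beta> \<le> B' \<longrightarrow>
    \<bar>iter_dirderiv (0, b, 0) j (profile \<gamma> l v) (r, u, \<beta>)\<bar> \<le> C * norm u powr (\<gamma> - real j)"
    for b :: 'a and j
  proof -
    let ?D = "iter_dirderiv (0, b, 0) j (profile \<gamma> l v)"
    let ?K = "{0..L'} \<times> sphere (0::'a) 1 \<times> cball (0::'a) B'"
    have "Ck_on 0 (profile_domain B) ?D"
      by (rule Ck_on_iter_dirderiv) (rule H)
    then have "continuous_on (profile_domain B) ?D" by simp
    then have "continuous_on ?K ?D"
      by (rule continuous_on_subset) (use B' in \<open>auto simp: profile_domain_def\<close>)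
    moreover have "compact ?K" by (intro compact_Times) auto
    ultimately have "bounded (?D ` ?K)" by (intro compact_imp_bounded compact_continuous_image)
    then obtain C where C: "\<And>x. x \<in> ?K \<Longrightarrow> \<bar>?D x\<bar> \<le> C" by (auto simp: bounded_iff)
    have "\<bar>?D (r, u, \<beta>)\<bar> \<le> max 0 C * norm u powr (\<gamma> - real j)"
      if r: "r \<ge> 0" and u: "u \<noteq> 0" and \<beta>: "norm \<beta> \<le> B'" for r u \<beta>
    proof (cases "r * norm u \<le> L'")
      case True
      have "?D (r, u, \<beta>) = norm u powr (\<gamma> - real j) * ?D (r * norm u, u /\<^sub>R norm u, \<beta>)"
        by (rule iter_dirderiv_profile_scale[OF H order_refl]) (use u \<beta> B' in auto)
      moreover have "\<bar>?D (r * norm u, u /\<^sub>R norm u, \<beta>)\<bar> \<le> max 0 C"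
        using C[of "(r * norm u, u /\<^sub>R norm u, \<beta>)"] True r u \<beta> by auto
      ultimately show ?thesis
        by (simp only: abs_mult mult.commute[of _ "norm u powr (\<gamma> - real j)"] abs_of_nonneg[OF powr_ge_zero])
          (rule mult_left_mono, simp_all)
    next
      case False
      have "norm (r *\<^sub>R u) - norm \<beta> \<le> norm (r *\<^sub>R u + \<beta>)"
        using norm_triangle_ineq2[of "r *\<^sub>R u" "- \<beta>"] by simp
      then have "norm (r *\<^sub>R u + \<beta>) > L" using False \<beta> LB B' r by simp
      from iter_dirderiv_profile_eq_0[OF v this] show ?thesis by simp
    qed
    then show ?thesis by blast
  qed
  then have "\<exists>C. \<forall>b j. \<forall>r\<ge>0. \<forall>u \<beta>. u \<noteq> 0 \<longrightarrow> norm \<beta> \<le> B' \<longrightarrow>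
    \<bar>iter_dirderiv (0, b, 0) j (profile \<gamma> l v) (r, u, \<beta>)\<bar> \<le> C b j * norm u powr (\<gamma> - real j)"
    by metis
  then obtain C :: "'a \<Rightarrow> nat \<Rightarrow> real" where C: "\<And>b j r u \<beta>. r \<ge> 0 \<Longrightarrow> u \<noteq> 0 \<Longrightarrow> norm \<beta> \<le> B' \<Longrightarrow>
    \<bar>iter_dirderiv (0, b, 0) j (profile \<gamma> l v) (r, u, \<beta>)\<bar> \<le> C b j * norm u powr (\<gamma> - real j)"
    by blast
  define C' where "C' = 1 + (\<Sum>p\<in>Basis \<times> {..k}. \<bar>C (fst p) (snd p)\<bar>)"
  have C': "C b j \<le> C'" if "b \<in> Basis" "j \<le> k" for b j
    using member_le_sum[of "(b, j)" "Basis \<times> {..k}" "\<lambda>p. \<bar>C (fst p) (snd p)\<bar>"] that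
    by (simp add: C'_def)
  have "C' > 0" unfolding C'_def by (intro add_pos_nonneg sum_nonneg) auto
  moreover have "\<bar>iter_dirderiv (0, b, 0) j (profile \<gamma> l v) (r, u, \<beta>)\<bar> \<le> C' * norm u powr (\<gamma> - real j)"
    if "j \<le> k" "b \<in> Basis" "r \<ge> 0" "u \<noteq> 0" "norm \<beta> \<le> B'" for b j r u \<beta>
    using C[OF that(3-5), of b j] mult_right_mono[OF C'[OF that(2,1)], of "norm u powr (\<gamma> - real j)"]
    by simp
  ultimately show ?thesis by blast
qed

section \<open>Periodicity and mean values; sums over the integer lattice\<close>

text \<open>
  For a periodic function (\<open>A = 0\<close>) every derivative has a zero, by Rolle's theorem, so all of them
  are controlled by the highest one. With almost periodic end values the mean value theorem still
  yields a point where the modulus of the derivative is at most \<open>A\<close>, and each order adds one such \<open>A\<close>.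
\<close>

lemma iterated_mean_value_bound:
  fixes e :: "nat \<Rightarrow> real \<Rightarrow> real"
  assumes d: "\<And>j t. j < k \<Longrightarrow> t \<in> {c..c + 1} \<Longrightarrow> (e j has_real_derivative e (Suc j) t) (at t)"
    and jump: "\<And>j. j < k \<Longrightarrow> \<bar>e j (c + 1) - e j c\<bar> \<le> A"
    and top: "\<And>t. t \<in> {c..c + 1} \<Longrightarrow> \<bar>e k t\<bar> \<le> S"
    and st: "s \<in> {c..c + 1}" "t \<in> {c..c + 1}" and k: "k \<ge> 1"
  shows "\<bar>e 0 t - e 0 s\<bar> \<le> real (k - 1) * A + S"
proof -
  \<comment> \<open>The interval has length one, so a bound on a derivative bounds the increments by the same constant.\<close>
  have lip: "\<bar>e j t - e j s\<bar> \<le> M"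
    if "j < k" "s \<in> {c..c + 1}" "t \<in> {c..c + 1}" and M: "\<And>t. t \<in> {c..c + 1} \<Longrightarrow> \<bar>e (Suc j) t\<bar> \<le> M"
    for j s t M
  proof -
    have "\<bar>e j b - e j a\<bar> \<le> M" if "a < b" "a \<in> {c..c + 1}" "b \<in> {c..c + 1}" for a b
    proof -
      have "\<exists>z. z > a \<and> z < b \<and> e j b - e j a = (b - a) * e (Suc j) z"
        using that by (intro MVT2 d[OF \<open>j < k\<close>]) auto
      then obtain z where z: "z > a" "z < b" "e j b - e j a = (b - a) * e (Suc j) z" by blast
      have "\<bar>(b - a) * e (Suc j) z\<bar> \<le> 1 * M"
        unfolding abs_mult using that z by (intro mult_mono M) auto
      then show ?thesis using z by simp
    qed
    from this[of s t] this[of t s] M[of s] that(2,3) show ?thesis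
      by (cases s t rule: linorder_cases) (auto simp: abs_minus_commute)
  qed
  \<comment> \<open>Induction downwards from order \<open>k\<close>: the modulus of \<open>e j\<close> is at most \<open>A\<close> at some point, and varies by no more than the
    bound on \<open>e (Suc j)\<close>.\<close>
  have main: "\<bar>e j t\<bar> \<le> real (k - j) * A + S" if "1 \<le> j" "j \<le> k" "t \<in> {c..c + 1}" for j t
    using that(2,1,3)
  proof (induction arbitrary: t rule: inc_induct)
    case base
    then show ?case using top by simp
  next
    case (step j)
    obtain i where i: "j = Suc i" using step.prems by (cases j) auto
    have "\<exists>z. z > c \<and> z < c + 1 \<and> e i (c + 1) - e i c = (c + 1 - c) * e (Suc i) z"
      using step.hyps i by (intro MVT2 d) auto
    then obtain z where z: "z > c" "z < c + 1" "e i (c + 1) - e i c = e j z"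
      by (auto simp: i)
    have "\<bar>e j z\<bar> \<le> A" using jump[of i] step.hyps i z(3) by simp
    moreover have "\<bar>e j t - e j z\<bar> \<le> real (k - Suc j) * A + S"
      by (rule lip) (use step z in auto)
    moreover have "real (k - j) * A = A + real (k - Suc j) * A"
      using step.hyps by (simp add: algebra_simps of_nat_diff)
    ultimately show ?case by linarith
  qed
  show ?thesis
    by (rule lip) (use k st main[of 1] in auto)
qed

definition integer_vectors :: "(real ^ 'n) set"
  where "integer_vectors = {z. \<forall>i. z $ i \<in> \<int>}"

text \<open>
  The parametrisation by integer-valued functions makes sums of products over a box of lattice points
  accessible to the distributive law \<open>prod_sum_PiE\<close>.
\<close>

lemma integer_box_eq:
  "{z \<in> integer_vectors. \<forall>i. \<bar>z $ i\<bar> \<le> real m} =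
    (\<lambda>\<phi>. (\<chi> i. of_int (\<phi> i)) :: real ^ 'n) ` (PiE UNIV (\<lambda>_. {- int m..int m}))" (is "?L = ?R")
proof
  show "?R \<subseteq> ?L"
  proof
    fix z :: "real ^ 'n" assume "z \<in> ?R"
    then obtain \<phi> where \<phi>: "\<phi> \<in> PiE UNIV (\<lambda>_. {- int m..int m})" and z: "z = (\<chi> i. of_int (\<phi> i))"
      by blast
    have "\<bar>\<phi> i\<bar> \<le> int m" for i using PiE_mem[OF \<phi>, of i] by auto
    then have "\<bar>real_of_int (\<phi> i)\<bar> \<le> real m" for i by (metis of_int_abs of_int_le_iff of_int_of_nat_eq)
    then show "z \<in> ?L" by (simp add: z integer_vectors_def)
  qed
  show "?L \<subseteq> ?R"
  proof
    fix z :: "real ^ 'n" assume z: "z \<in> ?L"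
    then have "\<forall>i. \<exists>q. z $ i = of_int q" by (fastforce simp: integer_vectors_def Ints_def)
    then obtain \<phi> where \<phi>: "\<And>i. z $ i = of_int (\<phi> i)" by metis
    have "\<phi> i \<in> {- int m..int m}" for i
    proof -
      have "\<bar>real_of_int (\<phi> i)\<bar> \<le> real m" using z \<phi> by simp
      then show ?thesis by (simp add: abs_le_iff)
    qed
    then show "z \<in> ?R" using \<phi> by (intro image_eqI[of _ _ \<phi>]) (auto simp: vec_eq_iff)
  qed
qed

lemma finite_integer_box: "finite {z \<in> integer_vectors :: (real ^ 'n) set. \<forall>i. \<bar>z $ i\<bar> \<le> real m}"
  unfolding integer_box_eq by (intro finite_imageI finite_PiE) auto

lemma finite_integer_vectors_bounded:
  "finite {z \<in> integer_vectors :: (real ^ 'n) set. norm z \<le> \<rho>}"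
proof -
  obtain m where m: "\<rho> \<le> real m" using real_arch_simple by blast
  have "\<bar>z $ i\<bar> \<le> real m" if "norm z \<le> \<rho>" for z :: "real ^ 'n" and i
    using component_le_norm_cart[of z i] m that by linarith
  then show ?thesis by (intro finite_subset[OF _ finite_integer_box[of m]]) auto
qed

text \<open>
  A telescoping bound: the summands for \<open>m + 1\<close> and \<open>- (m + 1)\<close> together are at most
  \<open>2 / (m + 1) - 2 / (m + 2)\<close>.
\<close>

lemma sum_inverse_square_int: "(\<Sum>q\<in>{- int m..int m}. 1 / (1 + \<bar>real_of_int q\<bar>)\<^sup>2) \<le> 3 - 2 / (real m + 1)"
proof (induction m)
  case (Suc m)
  have "{- int (Suc m)..int (Suc m)} = insert (- int (Suc m)) (insert (int (Suc m)) {- int m..int m})"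
    by auto
  then have "(\<Sum>q\<in>{- int (Suc m)..int (Suc m)}. 1 / (1 + \<bar>real_of_int q\<bar>)\<^sup>2)
      = 2 / (real m + 2)\<^sup>2 + (\<Sum>q\<in>{- int m..int m}. 1 / (1 + \<bar>real_of_int q\<bar>)\<^sup>2)"
    by (simp add: add.commute)
  also have "\<dots> \<le> 2 / (real m + 2)\<^sup>2 + (3 - 2 / (real m + 1))" using Suc by simp
  also have "2 / (real m + 2)\<^sup>2 \<le> 2 / ((real m + 1) * (real m + 2))"
    by (intro divide_left_mono) (auto simp: power2_eq_square)
  also have "2 / ((real m + 1) * (real m + 2)) = 2 / (real m + 1) - 2 / (real m + 2)"
    by (simp add: field_simps)
  finally show ?case by (simp add: algebra_simps)
qed simp

lemma sum_prod_inverse_square: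
  fixes F :: "(real ^ 'n) set"
  assumes "finite F" "F \<subseteq> integer_vectors"
  shows "(\<Sum>z\<in>F. \<Prod>i\<in>UNIV. 9 / (1 + \<bar>z $ i\<bar>)\<^sup>2) \<le> 27 ^ CARD('n)"
proof -
  obtain M where M: "\<And>z. z \<in> F \<Longrightarrow> norm z \<le> M"
    using finite_imp_bounded[OF assms(1)] by (auto simp: bounded_iff)
  obtain m where m: "M \<le> real m" using real_arch_simple by blast
  let ?B = "{z \<in> integer_vectors :: (real ^ 'n) set. \<forall>i. \<bar>z $ i\<bar> \<le> real m}"
  let ?P = "PiE (UNIV :: 'n set) (\<lambda>_. {- int m..int m})"
  let ?v = "(\<lambda>\<phi>. (\<chi> i. of_int (\<phi> i)) :: real ^ 'n)"
  have "\<bar>z $ i\<bar> \<le> real m" if "z \<in> F" for z i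
    using component_le_norm_cart[of z i] M[OF that] m by linarith
  then have FB: "F \<subseteq> ?B" using assms(2) by auto
  have "(\<Sum>z\<in>F. \<Prod>i\<in>UNIV. 9 / (1 + \<bar>z $ i\<bar>)\<^sup>2) \<le> (\<Sum>z\<in>?B. \<Prod>i\<in>UNIV. 9 / (1 + \<bar>z $ i\<bar>)\<^sup>2)"
    by (rule sum_mono2[OF finite_integer_box FB]) (intro prod_nonneg, auto)
  also have "\<dots> = (\<Sum>\<phi>\<in>?P. \<Prod>i\<in>UNIV. 9 / (1 + \<bar>real_of_int (\<phi> i)\<bar>)\<^sup>2)"
    unfolding integer_box_eq
    by (subst sum.reindex) (auto simp: inj_on_def vec_eq_iff fun_eq_iff)
  also have "\<dots> = (\<Prod>i\<in>(UNIV :: 'n set). \<Sum>q\<in>{- int m..int m}. 9 / (1 + \<bar>real_of_int q\<bar>)\<^sup>2)"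
    by (rule prod_sum_PiE[symmetric]) auto
  also have "\<dots> \<le> (\<Prod>i\<in>(UNIV :: 'n set). 27)"
  proof (rule prod_mono)
    have "(\<Sum>q\<in>{- int m..int m}. 9 / (1 + \<bar>real_of_int q\<bar>)\<^sup>2) = 9 * (\<Sum>q\<in>{- int m..int m}. 1 / (1 + \<bar>real_of_int q\<bar>)\<^sup>2)"
      by (simp add: sum_distrib_left)
    also have "\<dots> \<le> 9 * 3"
      using sum_inverse_square_int[of m] by (intro mult_left_mono) (auto intro: order_trans)
    finally show "0 \<le> (\<Sum>q\<in>{- int m..int m}. 9 / (1 + \<bar>real_of_int q\<bar>)\<^sup>2) \<and> (\<Sum>q\<in>{- int m..int m}. 9 / (1 + \<bar>real_of_int q\<bar>)\<^sup>2) \<le> (27::real)"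
      by (simp add: sum_nonneg)
  qed
  finally show ?thesis by simp
qed

text \<open>
  A decay of order \<open>2 n\<close> splits into a product of inverse squares over the \<open>n\<close> coordinates, and the
  product is summable by \<open>sum_prod_inverse_square\<close>. In the application
  \<open>x\<close> is a lattice point \<open>z\<close> shifted by at most one in every coordinate.
\<close>

lemma powr_le_prod_inverse_square:
  fixes x z :: "real ^ 'n"
  assumes "q \<le> - 2 * real CARD('n)" "norm x \<ge> 1" "\<And>i. \<bar>z $ i\<bar> \<le> \<bar>x $ i\<bar> + 1"
  shows "norm x powr q \<le> (\<Prod>i\<in>UNIV. 9 / (1 + \<bar>z $ i\<bar>)\<^sup>2)"
proof -
  have "norm x powr q \<le> norm x powr (- 2 * real CARD('n))"
    using assms by (intro powr_mono) auto
  also have "\<dots> = norm x powr (- real (2 * CARD('n)))" by simp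
  also have "\<dots> = (1 / norm x) ^ (2 * CARD('n))"
    using assms(2) by (simp only: powr_minus powr_realpow power_one_over) (simp add: powr_realpow field_simps)
  also have "\<dots> = (\<Prod>i\<in>(UNIV :: 'n set). (1 / norm x)\<^sup>2)" by (simp add: power_mult)
  also have "\<dots> \<le> (\<Prod>i\<in>UNIV. (3 / (1 + \<bar>z $ i\<bar>))\<^sup>2)"
  proof (intro prod_mono conjI power_mono)
    fix i :: 'n
    have "1 + \<bar>z $ i\<bar> \<le> 3 * norm x"
      using component_le_norm_cart[of x i] assms(3)[of i] assms(2) by linarith
    moreover have "norm x > 0" "1 + \<bar>z $ i\<bar> > 0" using assms(2) by auto
    ultimately show "1 / norm x \<le> 3 / (1 + \<bar>z $ i\<bar>)" by (simp add: field_simps)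
  qed auto
  finally show ?thesis by (simp add: power_divide)
qed

section \<open>Derivatives of lattice sums of a singular kernel\<close>

text \<open>
  The threshold leaves a margin: a point of the unit cell around any other lattice point is at distance
  at least one from every singularity \<open>\<alpha>\<close> in the unit cell around the origin.
\<close>

definition near_vectors :: "(real ^ 'n) set"
  where "near_vectors = {z \<in> integer_vectors. \<forall>i. \<bar>z $ i\<bar> \<le> 1}"

lemma finite_near_vectors: "finite (near_vectors :: (real ^ 'n) set)"
  using finite_integer_box[of 1] by (simp add: near_vectors_def)

lemma far_vector_component:
  assumes "z \<in> integer_vectors - near_vectors"
  obtains i where "\<bar>z $ i\<bar> \<ge> 2"
proof -
  obtain i where i: "\<bar>z $ i\<bar> > 1" "z $ i \<in> \<int>"
    using assms by (auto simp: near_vectors_def integer_vectors_def not_le)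
  then obtain q where "z $ i = of_int q" by (auto elim: Ints_cases)
  with i(1) have "\<bar>q\<bar> > 1" by simp
  then have "\<bar>q\<bar> \<ge> 2" by simp
  then have "\<bar>z $ i\<bar> \<ge> 2"
    unfolding \<open>z $ i = of_int q\<close> by (metis of_int_abs of_int_le_iff of_int_numeral)
  then show ?thesis by (rule that)
qed

lemma norm_le_card_cart:
  fixes x :: "real ^ 'n"
  assumes "\<And>i. \<bar>x $ i\<bar> \<le> c"
  shows "norm x \<le> real CARD('n) * c"
proof -
  have "norm x \<le> (\<Sum>i\<in>UNIV. \<bar>x $ i\<bar>)" by (rule norm_le_l1_cart)
  also have "\<dots> \<le> (\<Sum>i\<in>(UNIV :: 'n set). c)" by (intro sum_mono assms)
  finally show ?thesis by simp
qed

text \<open>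
  A kernel with a point singularity of order \<open>\<gamma>\<close> at \<open>\<alpha>\<close> and support in a ball of radius \<open>\<rho>\<close>. Only
  pure derivatives along the coordinate axes occur: \<open>K i j\<close> is the \<open>j\<close>-th derivative of \<open>K0\<close> in
  direction \<open>i\<close>. The value of \<open>K0\<close> at the singularity is normalised to zero so that
  the bound of order zero holds everywhere (\<open>0 powr \<gamma> = 0\<close>).
\<close>

locale singular_kernel =
  fixes \<alpha> :: "real ^ 'n" and K :: "'n \<Rightarrow> nat \<Rightarrow> real ^ 'n \<Rightarrow> real" and K0 :: "real ^ 'n \<Rightarrow> real"
    and \<gamma> C \<rho> :: real and k :: nat
  assumes \<alpha>: "\<bar>\<alpha> $ i\<bar> \<le> 1 / 2"
    and K0: "K i 0 = K0"
    and K0_measurable [measurable]: "K0 \<in> borel_measurable borel"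
    and K0_singularity: "K0 \<alpha> = 0"
    and deriv: "j < k \<Longrightarrow> y + t *\<^sub>R axis i 1 \<noteq> \<alpha> \<Longrightarrow>
      ((\<lambda>t. K i j (y + t *\<^sub>R axis i 1)) has_real_derivative K i (Suc j) (y + t *\<^sub>R axis i 1)) (at t)"
    and bound: "j \<le> k \<Longrightarrow> x \<noteq> \<alpha> \<Longrightarrow> \<bar>K i j x\<bar> \<le> C * norm (x - \<alpha>) powr (\<gamma> - real j)"
    and support: "norm x > \<rho> \<Longrightarrow> K i j x = 0"
    and k: "1 \<le> k" "\<gamma> + 2 * real CARD('n) \<le> real k"
    and C: "C > 0"
begin

text \<open>
  The far lattice points, cut down to a finite set by the support of the kernel. The slack
  \<open>1 + n\<close> exceeds the norm of every shift within a unit cell, and of such a shift plus one unit vector,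
  so that lattice sums over all far points are sums over this set.
\<close>

definition relevant :: "(real ^ 'n) set"
  where "relevant = {z \<in> integer_vectors - near_vectors. norm z \<le> \<rho> + 1 + real CARD('n)}"

lemma finite_relevant: "finite relevant"
  using finite_integer_vectors_bounded[of "\<rho> + 1 + real CARD('n)"]
  by (rule rev_finite_subset) (auto simp: relevant_def)

text \<open>
  A far lattice point has a coordinate of modulus at least two, from which the shift \<open>a\<close> within the
  unit cell and \<open>\<alpha>\<close> can each take away only one half.
\<close>

lemma far_distance:
  assumes "z \<in> integer_vectors - near_vectors" "\<And>i. \<bar>a $ i\<bar> \<le> 1 / 2"
  shows "norm (z + a - \<alpha>) \<ge> 1" "z + a \<noteq> \<alpha>"
proof -
  obtain i where "\<bar>z $ i\<bar> \<ge> 2" using far_vector_component[OF assms(1)] .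
  then have "\<bar>(z + a - \<alpha>) $ i\<bar> \<ge> 1"
    using \<alpha>[of i] assms(2)[of i] by simp
  then show *: "norm (z + a - \<alpha>) \<ge> 1"
    using component_le_norm_cart[of "z + a - \<alpha>" i] by linarith
  then show "z + a \<noteq> \<alpha>" by auto
qed

lemma irrelevant_eq_0:
  assumes "z \<in> integer_vectors - near_vectors - relevant" "norm a \<le> 1 + real CARD('n)"
  shows "K i j (z + a) = 0"
proof (rule support)
  have "norm z > \<rho> + 1 + real CARD('n)" using assms(1) by (auto simp: relevant_def)
  then show "norm (z + a) > \<rho>"
    using norm_triangle_ineq2[of z "- a"] assms(2) by simp
qed

lemma K_far_bound:
  assumes "z \<in> integer_vectors - near_vectors" "\<And>i. \<bar>a $ i\<bar> \<le> 1 / 2" "j \<le> k"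
    "\<And>i. \<bar>(z + a - \<alpha>) $ i\<bar> \<le> 3"
  shows "\<bar>K i j (z + a)\<bar> \<le> C * (3 * real CARD('n)) powr \<bar>\<gamma>\<bar>"
proof -
  have 1: "norm (z + a - \<alpha>) \<ge> 1" and 2: "z + a \<noteq> \<alpha>"
    using far_distance[OF assms(1,2)] by auto
  have "norm (z + a - \<alpha>) \<le> 3 * real CARD('n)"
    using norm_le_card_cart[OF assms(4)] by simp
  then have "norm (z + a - \<alpha>) powr (\<gamma> - real j) \<le> (3 * real CARD('n)) powr \<bar>\<gamma>\<bar>"
    using 1 by (intro order_trans[OF powr_mono[of _ "\<bar>\<gamma>\<bar>"] powr_mono2]) auto
  then show ?thesis
    using bound[OF assms(3) 2, of i] mult_left_mono[of _ _ C] C by (meson less_imp_le order_trans)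
qed

definition jump_bound :: real
  where "jump_bound = 2 * real (card (near_vectors :: (real ^ 'n) set)) * (C * (3 * real CARD('n)) powr \<bar>\<gamma>\<bar>)"

text \<open>
  The two sums are over the far lattice points and over their translates by one unit vector. They
  differ by the nonzero terms of the symmetric difference; there either the point or its predecessor is a
  near lattice point, so there are at most twice as many such terms as near points, and each of them
  is evaluated within a bounded distance of the singularity but not closer than one.
\<close>

lemma sum_jump:
  fixes w :: "real ^ 'n"
  assumes "j \<le> k" "\<And>m. \<bar>w $ m\<bar> \<le> 1 / 2" "w $ i = - 1 / 2"
  shows "\<bar>(\<Sum>z\<in>relevant. K i j (z + w + axis i 1)) - (\<Sum>z\<in>relevant. K i j (z + w))\<bar> \<le> jump_bound"
proof -
  let ?e = "axis i 1 :: real ^ 'n"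
  let ?N = "relevant" and ?N' = "(\<lambda>z. z + ?e) ` relevant"
  let ?c = "C * (3 * real CARD('n)) powr \<bar>\<gamma>\<bar>"
  define g where "g z = K i j (z + w)" for z
  have e_int: "z + ?e \<in> integer_vectors" "z - ?e \<in> integer_vectors" if "z \<in> integer_vectors" for z
    using that by (auto simp: integer_vectors_def axis_def)
  have we: "\<bar>(w + ?e) $ m\<bar> \<le> 1 / 2" for m
    using assms(2)[of m] assms(3) by (auto simp: axis_def)
  have nw: "norm w \<le> 1 + real CARD('n)" "norm (w + ?e) \<le> 1 + real CARD('n)"
    using norm_le_card_cart[of w "1 / 2", OF assms(2)] norm_le_card_cart[of "w + ?e" "1 / 2", OF we]
    by simp_all
  have fin: "finite ?N" "finite ?N'" using finite_relevant by auto
  have "(\<Sum>z\<in>relevant. K i j (z + w + ?e)) = sum g ?N'"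
    by (subst sum.reindex) (auto simp: g_def inj_on_def algebra_simps)
  also have "sum g ?N' = sum g (?N' \<inter> ?N) + sum g (?N' - ?N)"
    using sum.Int_Diff[OF fin(2)] .
  finally have 1: "(\<Sum>z\<in>relevant. K i j (z + w + ?e)) = sum g (?N' \<inter> ?N) + sum g (?N' - ?N)" .
  have 2: "(\<Sum>z\<in>relevant. K i j (z + w)) = sum g (?N' \<inter> ?N) + sum g (?N - ?N')"
    using sum.Int_Diff[OF fin(1), of g ?N'] by (simp add: g_def Int_commute)
  have comp: "\<bar>(z + w - \<alpha>) $ m\<bar> \<le> 3" if "\<bar>z $ m\<bar> \<le> 2" for z m
    using that assms(2)[of m] \<alpha>[of m] by (simp add: abs_le_iff) linarith
  \<comment> \<open>Points that occur in the translated sum only: a nonzero term comes from a near point.\<close>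
  have 3: "\<bar>sum g (?N' - ?N)\<bar> \<le> real (card (near_vectors :: (real ^ 'n) set)) * ?c"
  proof -
    have "sum g (?N' - ?N) = sum g ((?N' - ?N) \<inter> near_vectors)"
    proof (rule sum.mono_neutral_right)
      show "\<forall>z\<in>?N' - ?N - (?N' - ?N) \<inter> near_vectors. g z = 0"
        unfolding g_def using e_int by (intro ballI irrelevant_eq_0 nw) (auto simp: relevant_def)
    qed (use fin in auto)
    also have "\<bar>\<dots>\<bar> \<le> (\<Sum>z\<in>(?N' - ?N) \<inter> near_vectors. \<bar>g z\<bar>)" by (rule sum_abs)
    also have "\<dots> \<le> (\<Sum>z\<in>(?N' - ?N) \<inter> near_vectors. ?c)"
    proof (rule sum_mono)
      fix z assume z: "z \<in> (?N' - ?N) \<inter> near_vectors"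
      then obtain z' where z': "z = z' + ?e" "z' \<in> integer_vectors - near_vectors"
        by (auto simp: relevant_def)
      have "\<bar>K i j (z' + (w + ?e))\<bar> \<le> ?c"
      proof (rule K_far_bound[OF z'(2) we assms(1)])
        fix m
        have "\<bar>z $ m\<bar> \<le> 2" using z by (auto simp: near_vectors_def intro: order_trans)
        from comp[OF this] show "\<bar>(z' + (w + ?e) - \<alpha>) $ m\<bar> \<le> 3" by (simp add: z' algebra_simps)
      qed
      then show "\<bar>g z\<bar> \<le> ?c" by (simp add: g_def z' algebra_simps)
    qed
    also have "\<dots> = real (card ((?N' - ?N) \<inter> near_vectors)) * ?c" by simp
    also have "\<dots> \<le> real (card (near_vectors :: (real ^ 'n) set)) * ?c"
      using C by (intro mult_right_mono of_nat_mono card_mono finite_near_vectors) auto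
    finally show ?thesis .
  qed
  \<comment> \<open>Points that occur in the other sum only: a nonzero term comes from a point whose predecessor is near.\<close>
  have 4: "\<bar>sum g (?N - ?N')\<bar> \<le> real (card (near_vectors :: (real ^ 'n) set)) * ?c"
  proof -
    let ?M = "(\<lambda>z. z + ?e) ` near_vectors"
    have "sum g (?N - ?N') = sum g ((?N - ?N') \<inter> ?M)"
    proof (rule sum.mono_neutral_right)
      show "\<forall>z\<in>?N - ?N' - (?N - ?N') \<inter> ?M. g z = 0"
      proof
        fix z assume z: "z \<in> ?N - ?N' - (?N - ?N') \<inter> ?M"
        have im: "z \<in> (\<lambda>z. z + ?e) ` X \<longleftrightarrow> z - ?e \<in> X" for X
          by (auto simp: image_iff intro!: bexI[of _ "z - ?e"])
        have "z - ?e \<in> integer_vectors - near_vectors - relevant"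
          using z e_int[of z] by (auto simp: im relevant_def)
        from irrelevant_eq_0[OF this nw(2)] show "g z = 0" by (simp add: g_def)
      qed
    qed (use fin in auto)
    also have "\<bar>\<dots>\<bar> \<le> (\<Sum>z\<in>(?N - ?N') \<inter> ?M. \<bar>g z\<bar>)" by (rule sum_abs)
    also have "\<dots> \<le> (\<Sum>z\<in>(?N - ?N') \<inter> ?M. ?c)"
    proof (rule sum_mono)
      fix z assume z: "z \<in> (?N - ?N') \<inter> ?M"
      then have z': "z \<in> integer_vectors - near_vectors" by (auto simp: relevant_def)
      show "\<bar>g z\<bar> \<le> ?c"
        unfolding g_def
      proof (rule K_far_bound[OF z' assms(2) assms(1)])
        fix m
        obtain y where "z = y + ?e" "y \<in> near_vectors" using z by auto
        then have "\<bar>z $ m\<bar> \<le> 2" by (auto simp: near_vectors_def axis_def abs_le_iff)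
          (smt (verit) abs_le_iff)+
        from comp[OF this] show "\<bar>(z + w - \<alpha>) $ m\<bar> \<le> 3" .
      qed
    qed
    also have "\<dots> = real (card ((?N - ?N') \<inter> ?M)) * ?c" by simp
    also have "\<dots> \<le> real (card (near_vectors :: (real ^ 'n) set)) * ?c"
    proof (intro mult_right_mono of_nat_mono)
      have "card ((?N - ?N') \<inter> ?M) \<le> card ?M"
        by (intro card_mono finite_imageI finite_near_vectors) auto
      also have "\<dots> \<le> card (near_vectors :: (real ^ 'n) set)" by (rule card_image_le[OF finite_near_vectors])
      finally show "card ((?N - ?N') \<inter> ?M) \<le> card (near_vectors :: (real ^ 'n) set)" .
    qed (use C in auto)
    finally show ?thesis .
  qed
  show ?thesis using 3 4 unfolding 1 2 jump_bound_def by linarith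
qed

lemma sum_top_bound:
  assumes "\<And>m. \<bar>a $ m\<bar> \<le> 1 / 2"
  shows "\<bar>\<Sum>z\<in>relevant. K i k (z + a)\<bar> \<le> C * 27 ^ CARD('n)"
proof -
  have "\<bar>\<Sum>z\<in>relevant. K i k (z + a)\<bar> \<le> (\<Sum>z\<in>relevant. \<bar>K i k (z + a)\<bar>)" by (rule sum_abs)
  also have "\<dots> \<le> (\<Sum>z\<in>relevant. C * (\<Prod>i\<in>UNIV. 9 / (1 + \<bar>z $ i\<bar>)\<^sup>2))"
  proof (rule sum_mono)
    fix z assume "z \<in> relevant"
    then have z: "z \<in> integer_vectors - near_vectors" by (simp add: relevant_def)
    note d = far_distance[OF z assms]
    have "\<bar>z $ m\<bar> \<le> \<bar>(z + a - \<alpha>) $ m\<bar> + 1" for m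
      using assms[of m] \<alpha>[of m] by simp
    from powr_le_prod_inverse_square[OF _ d(1) this, of "\<gamma> - real k"] k(2)
    have "norm (z + a - \<alpha>) powr (\<gamma> - real k) \<le> (\<Prod>i\<in>UNIV. 9 / (1 + \<bar>z $ i\<bar>)\<^sup>2)" by simp
    from mult_left_mono[OF this, of C] bound[OF order_refl d(2), of i] C
    show "\<bar>K i k (z + a)\<bar> \<le> C * (\<Prod>i\<in>UNIV. 9 / (1 + \<bar>z $ i\<bar>)\<^sup>2)"
      by (meson less_imp_le order_trans)
  qed
  also have "\<dots> = C * (\<Sum>z\<in>relevant. (\<Prod>i\<in>UNIV. 9 / (1 + \<bar>z $ i\<bar>)\<^sup>2))" by (simp add: sum_distrib_left)
  also have "\<dots> \<le> C * 27 ^ CARD('n)"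
    using C finite_relevant by (intro mult_left_mono sum_prod_inverse_square) (auto simp: relevant_def)
  finally show ?thesis .
qed

definition step_bound :: real
  where "step_bound = real (k - 1) * jump_bound + C * 27 ^ CARD('n)"

definition far_sum :: "real ^ 'n \<Rightarrow> real"
  where "far_sum a = (\<Sum>z\<in>relevant. K0 (z + a))"

lemma far_sum_coordinate_step:
  fixes w :: "real ^ 'n"
  assumes w: "\<And>m. \<bar>w $ m\<bar> \<le> 1 / 2" "w $ i = 0" and st: "\<bar>s\<bar> \<le> 1 / 2" "\<bar>t\<bar> \<le> 1 / 2"
  shows "\<bar>far_sum (w + t *\<^sub>R axis i 1) - far_sum (w + s *\<^sub>R axis i 1)\<bar> \<le> step_bound"
proof -
  let ?e = "axis i 1 :: real ^ 'n"
  define e where "e j t = (\<Sum>z\<in>relevant. K i j (z + w + t *\<^sub>R ?e))" for j t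
  have wt: "\<bar>(w + t *\<^sub>R ?e) $ m\<bar> \<le> 1 / 2" if "\<bar>t\<bar> \<le> 1 / 2" for t m
    using w(1)[of m] w(2) that by (auto simp: axis_def)
  have "\<bar>e 0 t - e 0 s\<bar> \<le> real (k - 1) * jump_bound + C * 27 ^ CARD('n)"
  proof (rule iterated_mean_value_bound[where c = "- 1 / 2" and e = e])
    fix j and t :: real assume jt: "j < k" "t \<in> {- 1 / 2..- 1 / 2 + 1 :: real}"
    then have t: "\<bar>t\<bar> \<le> 1 / 2" by auto
    have "z + w + t *\<^sub>R ?e \<noteq> \<alpha>" if "z \<in> relevant" for z
      using far_distance(2)[of z "w + t *\<^sub>R ?e", OF _ wt[OF t]] that by (simp add: relevant_def add.assoc)
    then show "(e j has_real_derivative e (Suc j) t) (at t)"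
      unfolding e_def using jt(1) by (intro DERIV_sum deriv) auto
  next
    fix j assume "j < k"
    have "\<bar>(\<Sum>z\<in>relevant. K i j (z + (w + (- 1 / 2) *\<^sub>R ?e) + ?e)) - (\<Sum>z\<in>relevant. K i j (z + (w + (- 1 / 2) *\<^sub>R ?e)))\<bar> \<le> jump_bound"
      by (rule sum_jump) (use \<open>j < k\<close> wt[of "- 1 / 2"] w(2) in \<open>auto simp: axis_def\<close>)
    moreover have "e j (- 1 / 2 + 1) = (\<Sum>z\<in>relevant. K i j (z + (w + (- 1 / 2) *\<^sub>R ?e) + ?e))"
      unfolding e_def by (intro sum.cong refl arg_cong[of _ _ "K i j"]) (simp add: vec_eq_iff)
    moreover have "e j (- 1 / 2) = (\<Sum>z\<in>relevant. K i j (z + (w + (- 1 / 2) *\<^sub>R ?e)))"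
      unfolding e_def by (simp only: add.assoc)
    ultimately show "\<bar>e j (- 1 / 2 + 1) - e j (- 1 / 2)\<bar> \<le> jump_bound" by simp
  next
    fix t :: real assume "t \<in> {- 1 / 2..- 1 / 2 + 1}"
    then have t: "\<bar>t\<bar> \<le> 1 / 2" by auto
    show "\<bar>e k t\<bar> \<le> C * 27 ^ CARD('n)"
      using sum_top_bound[OF wt[OF t], of i] by (simp add: e_def add.assoc)
  qed (use st k in auto)
  then show ?thesis by (simp add: e_def far_sum_def step_bound_def K0 add.assoc)
qed

text \<open>
  Two points of the unit cell are joined by moving one coordinate at a time.
\<close>

lemma far_sum_oscillation:
  assumes "\<And>m. \<bar>a $ m\<bar> \<le> 1 / 2" "\<And>m. \<bar>b $ m\<bar> \<le> 1 / 2"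
  shows "\<bar>far_sum a - far_sum b\<bar> \<le> real CARD('n) * step_bound"
proof -
  have "\<bar>far_sum a - far_sum b\<bar> \<le> real (card I) * step_bound"
    if "\<And>m. \<bar>a $ m\<bar> \<le> 1 / 2" "\<And>m. m \<notin> I \<Longrightarrow> a $ m = b $ m" for I a
    using finite[of I] that
  proof (induction I arbitrary: a rule: finite_induct)
    case empty
    then have "a = b" by (simp add: vec_eq_iff)
    then show ?case by simp
  next
    case (insert i I)
    let ?w = "a - (a $ i) *\<^sub>R axis i 1"
    define c where "c = ?w + (b $ i) *\<^sub>R axis i 1"
    have c: "c $ m = (if m = i then b $ i else a $ m)" for m by (simp add: c_def axis_def)
    have "\<bar>far_sum c - far_sum b\<bar> \<le> real (card I) * step_bound"
      using insert.prems assms(2) by (intro insert.IH) (auto simp: c)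
    moreover have "\<bar>far_sum (?w + (a $ i) *\<^sub>R axis i 1) - far_sum c\<bar> \<le> step_bound"
      unfolding c_def
      by (rule far_sum_coordinate_step) (use insert.prems(1) assms(2) in \<open>auto simp: axis_def\<close>)
    ultimately show ?case using insert.hyps by (simp add: algebra_simps)
  qed
  from this[of a UNIV] assms(1) show ?thesis by simp
qed

end

section \<open>Integrals over unit cells and near the singularity\<close>

lemma lborel_integral_affine:
  fixes f :: "'a::euclidean_space \<Rightarrow> real"
  assumes f: "f \<in> borel_measurable borel" and c: "c > 0"
  shows "integral\<^sup>L lborel f = c ^ DIM('a) * integral\<^sup>L lborel (\<lambda>x. f (t + c *\<^sub>R x))"
proof -
  have "integral\<^sup>L lborel f
      = integral\<^sup>L (density (distr lborel borel (\<lambda>x. t + c *\<^sub>R x)) (\<lambda>_. ennreal (c ^ DIM('a)))) f"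
    using lborel_affine[of c t] c by simp
  also have "\<dots> = integral\<^sup>L (distr lborel borel (\<lambda>x. t + c *\<^sub>R x)) (\<lambda>x. c ^ DIM('a) *\<^sub>R f x)"
    using f c by (intro integral_density) auto
  also have "\<dots> = integral\<^sup>L lborel (\<lambda>x. c ^ DIM('a) *\<^sub>R f (t + c *\<^sub>R x))"
    using f by (intro integral_distr) auto
  finally show ?thesis by simp
qed

lemma lborel_integrable_translate:
  fixes f :: "'a::euclidean_space \<Rightarrow> real"
  assumes "integrable lborel f"
  shows "integrable lborel (\<lambda>x. f (t + x))"
proof -
  have "distr lborel borel (\<lambda>x::'a. t + x) = lborel"
    using lborel_affine[of 1 t] by (simp add: density_1)
  then have "integrable (distr lborel borel (\<lambda>x. t + x)) f" using assms by simp
  then show ?thesis using assms by (subst (asm) integrable_distr_eq) auto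
qed

lemma dyadic_shell:
  fixes x R :: real
  assumes "0 < x" "x \<le> R"
  obtains i :: nat where "R / 2 ^ i / 2 < x" "x \<le> R / 2 ^ i"
proof -
  have "\<exists>i. R / 2 ^ i < x"
  proof -
    obtain i where "R / x < 2 ^ i" using real_arch_pow[of 2 "R / x"] by auto
    then show ?thesis using assms by (intro exI[of _ i]) (simp add: field_simps)
  qed
  then obtain j where j: "R / 2 ^ j < x" "\<And>i. i < j \<Longrightarrow> \<not> R / 2 ^ i < x"
    using exists_least_iff[of "\<lambda>i. R / 2 ^ i < x"] by blast
  then obtain i where "j = Suc i" using assms by (cases j) auto
  with j(1) j(2)[of i] show ?thesis by (intro that[of i]) (auto simp: field_simps)
qed

lemma powr_le_dyadic:
  fixes x y \<gamma> :: real
  assumes "y / 2 < x" "x \<le> y" "y > 0"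
  shows "x powr \<gamma> \<le> 2 powr \<bar>\<gamma>\<bar> * y powr \<gamma>"
proof -
  have x: "x > 0" using assms by simp
  have "(x / y) powr \<gamma> \<le> 2 powr \<bar>\<gamma>\<bar>"
  proof (cases "\<gamma> \<ge> 0")
    case True
    then have "(x / y) powr \<gamma> \<le> 1 powr \<gamma>" using assms x by (intro powr_mono2) auto
    also have "\<dots> \<le> 2 powr \<bar>\<gamma>\<bar>" using ge_one_powr_ge_zero[of 2 "\<bar>\<gamma>\<bar>"] by simp
    finally show ?thesis .
  next
    case False
    have "(x / y) powr \<gamma> = (y / x) powr \<bar>\<gamma>\<bar>"
      using False x assms by (simp add: powr_divide powr_minus field_simps)
    also have "\<dots> \<le> 2 powr \<bar>\<gamma>\<bar>" using assms x by (intro powr_mono2) (auto simp: field_simps)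
    finally show ?thesis .
  qed
  then have "(x / y) powr \<gamma> * y powr \<gamma> \<le> 2 powr \<bar>\<gamma>\<bar> * y powr \<gamma>" by (rule mult_right_mono) simp
  moreover have "(x / y) powr \<gamma> * y powr \<gamma> = x powr \<gamma>"
    using x assms by (simp add: powr_divide)
  ultimately show ?thesis by simp
qed

text \<open>
  On the dyadic shell of outer radius \<open>R / 2 ^ i\<close> the function is comparable to
  \<open>(R / 2 ^ i) powr \<gamma>\<close>, and the volume of the shell is at most a constant times
  \<open>(R / 2 ^ i) ^ n\<close>. So the integral is dominated by a geometric series of ratio
  \<open>2 powr (- (\<gamma> + n)) < 1\<close>.
\<close>

lemma integrable_norm_powr_cball:
  assumes \<gamma>: "\<gamma> > - real DIM('a::euclidean_space)" and R: "R > 0"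
  shows "integrable lborel (\<lambda>u::'a. indicator (cball 0 R) u * norm u powr \<gamma>)"
proof (rule integrableI_bounded)
  let ?f = "\<lambda>u::'a. indicator (cball 0 R) u * norm u powr \<gamma>"
  let ?n = "DIM('a)"
  define r where "r i = R / 2 ^ i" for i :: nat
  define c where "c i = 2 powr \<bar>\<gamma>\<bar> * r i powr \<gamma>" for i
  have r: "r i > 0" for i using R by (simp add: r_def)
  show "?f \<in> borel_measurable lborel"
    by (intro borel_measurable_times borel_measurable_indicator powr_real_measurable) auto
  have le: "ennreal (norm (?f u)) \<le> (\<Sum>i. ennreal (c i) * indicator (cball 0 (r i)) u)" for u :: 'a
  proof (cases "u = 0 \<or> norm u > R")
    case True
    then have 0: "?f u = 0" by auto
    show ?thesis unfolding 0 by simp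
  next
    case False
    then obtain i where i: "R / 2 ^ i / 2 < norm u" "norm u \<le> R / 2 ^ i"
      using dyadic_shell[of "norm u" R] by auto
    have "?f u \<le> c i"
      unfolding c_def using powr_le_dyadic[of "r i" "norm u" \<gamma>] i r False by (simp add: r_def)
    then have "ennreal (norm (?f u)) \<le> (\<Sum>j\<in>{i}. ennreal (c j) * indicator (cball 0 (r j)) u)"
      using i by (simp add: r_def ennreal_leI)
    also have "\<dots> \<le> (\<Sum>i. ennreal (c i) * indicator (cball 0 (r i)) u)"
      by (intro sum_le_suminf) auto
    finally show ?thesis .
  qed
  have "(\<integral>\<^sup>+u. ennreal (norm (?f u)) \<partial>lborel)
      \<le> (\<integral>\<^sup>+u. (\<Sum>i. ennreal (c i) * indicator (cball 0 (r i)) (u::'a)) \<partial>lborel)"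
    by (intro nn_integral_mono le)
  also have "\<dots> = (\<Sum>i. \<integral>\<^sup>+u. ennreal (c i) * indicator (cball 0 (r i)) (u::'a) \<partial>lborel)"
    by (intro nn_integral_suminf borel_measurable_times_ennreal borel_measurable_indicator) auto
  also have "\<dots> = (\<Sum>i. ennreal (c i * (unit_ball_vol ?n * r i ^ ?n)))"
    using r by (intro suminf_cong) (simp add: nn_integral_cmult_indicator emeasure_cball less_imp_le ennreal_mult c_def)
  also have "\<dots> = (\<Sum>i. ennreal (2 powr \<bar>\<gamma>\<bar> * R powr \<gamma> * unit_ball_vol ?n * R ^ ?n * (2 powr (- (\<gamma> + real ?n))) ^ i))"
  proof (intro suminf_cong arg_cong[of _ _ ennreal])
    fix i
    have "r i = R * 2 powr (- real i)"
      by (simp add: r_def powr_minus powr_realpow divide_inverse)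
    then have "r i powr \<gamma> = R powr \<gamma> * 2 powr (- \<gamma> * real i)"
      using R by (simp add: powr_mult powr_powr mult.commute)
    moreover have "(2 powr (- \<gamma>)) ^ i = (2::real) powr (- \<gamma> * real i)"
      by (subst powr_realpow[symmetric]) (simp_all add: powr_powr)
    ultimately have "r i powr \<gamma> = R powr \<gamma> * (2 powr (- \<gamma>)) ^ i" by simp
    moreover have "r i ^ ?n = R ^ ?n * (2 powr (- real ?n)) ^ i"
    proof -
      have "r i ^ ?n = R ^ ?n * inverse ((2 ^ i) ^ ?n)"
        by (simp only: r_def divide_inverse power_mult_distrib power_inverse)
      also have "((2::real) ^ i) ^ ?n = (2 ^ ?n) ^ i"
        by (simp only: power_mult[symmetric] mult.commute)
      also have "inverse ((2 ^ ?n) ^ i) = ((2::real) powr (- real ?n)) ^ i"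
        by (simp only: powr_minus power_inverse) (simp only: powr_realpow zero_less_numeral)
      finally show ?thesis .
    qed
    moreover have "(2 powr (- (\<gamma> + real ?n))) ^ i = (2 powr (- \<gamma>)) ^ i * ((2::real) powr (- real ?n)) ^ i"
      by (simp add: powr_add[symmetric] flip: power_mult_distrib)
    ultimately show "c i * (unit_ball_vol ?n * r i ^ ?n) = 2 powr \<bar>\<gamma>\<bar> * R powr \<gamma> * unit_ball_vol ?n * R ^ ?n * (2 powr (- (\<gamma> + real ?n))) ^ i"
      by (simp add: c_def)
  qed
  also have "\<dots> < \<infinity>"
  proof -
    have "(2::real) powr (- (\<gamma> + real ?n)) < 2 powr 0" using \<gamma> by (intro powr_less_mono) auto
    then have "summable (\<lambda>i. 2 powr \<bar>\<gamma>\<bar> * R powr \<gamma> * unit_ball_vol ?n * R ^ ?n * (2 powr (- (\<gamma> + real ?n))) ^ i)"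
      by (intro summable_mult summable_geometric) simp
    then show ?thesis
      using R by (subst suminf_ennreal2) auto
  qed
  finally show "(\<integral>\<^sup>+u. ennreal (norm (?f u)) \<partial>lborel) < \<infinity>" .
qed

text \<open>
  Half-open, so that the cells of the integer vectors partition the space.
\<close>

definition cell :: "real ^ 'n \<Rightarrow> (real ^ 'n) set"
  where "cell z = {x. \<forall>i. z $ i - 1 / 2 \<le> x $ i \<and> x $ i < z $ i + 1 / 2}"

lemma cell_measurable [measurable]: "cell z \<in> sets borel"
proof -
  have "cell z = (\<Inter>i. {x. z $ i - 1 / 2 \<le> x $ i} \<inter> {x. x $ i < z $ i + 1 / 2})"
    by (auto simp: cell_def)
  also have "\<dots> \<in> sets borel"
    by (intro sets.finite_INT sets.Int borel_closed borel_open closed_Collect_le open_Collect_less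
        continuous_intros) auto
  finally show ?thesis .
qed

lemma translate_in_cell_iff: "z + a \<in> cell z \<longleftrightarrow> a \<in> cell 0"
proof -
  have "(z $ i - 1 / 2 \<le> (z + a) $ i \<and> (z + a) $ i < z $ i + 1 / 2) \<longleftrightarrow>
      (0 $ i - 1 / 2 \<le> a $ i \<and> a $ i < 0 $ i + 1 / 2)" for i
    by auto
  then show ?thesis unfolding cell_def mem_Collect_eq by presburger
qed

lemma in_cell_0D:
  assumes "a \<in> cell 0"
  shows "\<bar>a $ i\<bar> \<le> 1 / 2"
proof -
  have "- 1 / 2 \<le> a $ i" "a $ i < 1 / 2" using assms by (auto simp: cell_def)
  then show ?thesis by linarith
qed

lemma ex_cell:
  fixes x :: "real ^ 'n"
  shows "\<exists>z\<in>integer_vectors. x \<in> cell z"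
proof
  let ?z = "(\<chi> i. of_int \<lfloor>x $ i + 1 / 2\<rfloor>) :: real ^ 'n"
  show "?z \<in> integer_vectors" by (simp add: integer_vectors_def)
  have "of_int \<lfloor>x $ i + 1 / 2\<rfloor> - 1 / 2 \<le> x $ i" "x $ i < of_int \<lfloor>x $ i + 1 / 2\<rfloor> + 1 / 2" for i
    using of_int_floor_le[of "x $ i + 1 / 2"] floor_correct[of "x $ i + 1 / 2"] by linarith+
  then show "x \<in> cell ?z" by (simp add: cell_def)
qed

lemma cell_unique:
  assumes "z \<in> integer_vectors" "y \<in> integer_vectors" "x \<in> cell z" "x \<in> cell y"
  shows "z = y"
proof (simp add: vec_eq_iff, rule allI)
  fix i
  obtain p q where pq: "z $ i = of_int p" "y $ i = of_int q"
    using assms(1,2) unfolding integer_vectors_def by (auto elim!: Ints_cases dest!: spec[of _ i])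
  have "\<bar>z $ i - y $ i\<bar> < 1" using assms(3,4) by (auto simp: cell_def abs_less_iff dest!: spec[of _ i])
  then have "\<bar>p - q\<bar> < 1" unfolding pq by linarith
  then show "z $ i = y $ i" by (simp add: pq)
qed

lemma measure_cell_0: "emeasure lborel (cell (0 :: real ^ 'n)) = 1"
proof -
  let ?l = "(\<chi> i. - 1 / 2) :: real ^ 'n" and ?u = "(\<chi> i. 1 / 2) :: real ^ 'n"
  have ul: "(?u - ?l) \<bullet> b = 1" "?l \<bullet> b \<le> ?u \<bullet> b" if "b \<in> Basis" for b
    using that by (auto simp: Basis_vec_def inner_axis)
  have "emeasure lborel (cbox ?l ?u) = 1" "emeasure lborel (box ?l ?u) = 1"
    using ul by (simp_all add: emeasure_lborel_cbox emeasure_lborel_box)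
  moreover have "box ?l ?u \<subseteq> cell 0" "cell 0 \<subseteq> cbox ?l ?u"
    by (auto simp: mem_box_cart cell_def less_imp_le)
  then have "emeasure lborel (box ?l ?u) \<le> emeasure lborel (cell (0 :: real ^ 'n))"
    "emeasure lborel (cell (0 :: real ^ 'n)) \<le> emeasure lborel (cbox ?l ?u)"
    by (auto intro!: emeasure_mono)
  ultimately show ?thesis by simp
qed

context singular_kernel begin

lemma K0_bound: "\<bar>K0 x\<bar> \<le> C * norm (x - \<alpha>) powr \<gamma>"
  using bound[of 0 x] K0 K0_singularity by (cases "x = \<alpha>") auto

lemma K0_far_eq_0: "z \<in> integer_vectors - near_vectors - relevant \<Longrightarrow> norm a \<le> 1 + real CARD('n) \<Longrightarrow> K0 (z + a) = 0"
  using irrelevant_eq_0[of z a undefined 0] by (simp add: K0)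

lemma integrable_near_majorant:
  assumes "\<gamma> > - real CARD('n)" "R > 0"
  shows "integrable lborel (\<lambda>x. indicator (cball \<alpha> R) x * norm (x - \<alpha>) powr \<gamma>)"
    and "integral\<^sup>L lborel (\<lambda>x. indicator (cball \<alpha> R) x * norm (x - \<alpha>) powr \<gamma>)
      = integral\<^sup>L lborel (\<lambda>u :: real ^ 'n. indicator (cball 0 R) u * norm u powr \<gamma>)"
proof -
  let ?f = "\<lambda>u :: real ^ 'n. indicator (cball 0 R) u * norm u powr \<gamma>"
  have f: "integrable lborel ?f" using assms by (intro integrable_norm_powr_cball) simp_all
  have eq: "?f (- \<alpha> + x) = indicator (cball \<alpha> R) x * norm (x - \<alpha>) powr \<gamma>" for x
    by (simp add: indicator_def dist_norm norm_minus_commute)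
  show "integrable lborel (\<lambda>x. indicator (cball \<alpha> R) x * norm (x - \<alpha>) powr \<gamma>)"
    using lborel_integrable_translate[OF f, of "- \<alpha>"] unfolding eq .
  show "integral\<^sup>L lborel (\<lambda>x. indicator (cball \<alpha> R) x * norm (x - \<alpha>) powr \<gamma>) = integral\<^sup>L lborel ?f"
  proof -
    have "integral\<^sup>L lborel ?f = integral\<^sup>L lborel (\<lambda>x. ?f (- \<alpha> + x))"
      using lborel_integral_affine[of ?f 1 "- \<alpha>"] borel_measurable_integrable[OF f] by simp
    then show ?thesis unfolding eq by simp
  qed
qed

lemma integrable_K0:
  assumes "\<gamma> > - real CARD('n)"
  shows "integrable lborel K0"
proof (rule Bochner_Integration.integrable_bound)
  let ?R = "1 + \<bar>\<rho>\<bar> + norm \<alpha>"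
  show "integrable lborel (\<lambda>x. C * (indicator (cball \<alpha> ?R) x * norm (x - \<alpha>) powr \<gamma>))"
    using integrable_near_majorant(1)[OF assms, of ?R] by (intro integrable_mult_right) (simp add: add_pos_nonneg)
  show "AE x in lborel. norm (K0 x) \<le> norm (C * (indicator (cball \<alpha> ?R) x * norm (x - \<alpha>) powr \<gamma>))"
  proof (intro AE_I2)
    fix x :: "real ^ 'n"
    show "norm (K0 x) \<le> norm (C * (indicator (cball \<alpha> ?R) x * norm (x - \<alpha>) powr \<gamma>))"
    proof (cases "norm x \<le> \<rho>")
      case True
      then have "x \<in> cball \<alpha> ?R"
        using norm_triangle_ineq4[of \<alpha> x] by (simp add: dist_norm)
      then show ?thesis using K0_bound[of x] C by simp
    next
      case False
      then have "K0 x = 0" using support[of x undefined 0] K0 by simp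
      then show ?thesis by simp
    qed
  qed
qed simp

definition near_region :: "(real ^ 'n) set"
  where "near_region = (\<Union>z\<in>near_vectors. cell z)"

lemma near_region_measurable [measurable]: "near_region \<in> sets borel"
  unfolding near_region_def by (intro sets.finite_UN finite_near_vectors cell_measurable)

text \<open>
  Outside the near region only the cells of relevant points matter, because the kernel vanishes on
  the cells of the other far points.
\<close>

lemma cell_decomposition:
  "K0 x = indicator near_region x * K0 x + (\<Sum>z\<in>relevant. indicator (cell z) x * K0 x)"
proof -
  obtain z where z: "z \<in> integer_vectors" "x \<in> cell z" using ex_cell by blast
  have rel: "y \<in> integer_vectors - near_vectors" if "y \<in> relevant" for y
    using that by (simp add: relevant_def)
  have only: "y = z" if "y \<in> integer_vectors" "x \<in> cell y" for y
    using cell_unique[OF that(1) z(1) that(2) z(2)] .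
  show ?thesis
  proof (cases "z \<in> relevant")
    case True
    have "(\<Sum>y\<in>relevant. indicator (cell y) x * K0 x) = (\<Sum>y\<in>{z}. indicator (cell y) x * K0 x)"
      by (rule sum.mono_neutral_right) (use finite_relevant True only rel in \<open>auto simp: indicator_def\<close>)
    moreover have "x \<notin> near_region"
      using only rel[OF True] by (auto simp: near_region_def near_vectors_def)
    ultimately show ?thesis using z by simp
  next
    case False
    then have 0: "(\<Sum>y\<in>relevant. indicator (cell y) x * K0 x) = 0"
      using only rel by (intro sum.neutral) (auto simp: indicator_def)
    show ?thesis
    proof (cases "z \<in> near_vectors")
      case True
      then have "x \<in> near_region" using z by (auto simp: near_region_def)
      then show ?thesis using 0 by simp
    next
      case nn: False
      have a: "x - z \<in> cell 0" using z(2) translate_in_cell_iff[of z "x - z"] by simp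
      have "norm (x - z) \<le> 1 + real CARD('n)"
        using norm_le_card_cart[of "x - z" "1 / 2", OF in_cell_0D[OF a]] by simp
      from K0_far_eq_0[OF _ this, of z] False nn z(1) have "K0 x = 0" by simp
      then show ?thesis by simp
    qed
  qed
qed

lemma integral_cell:
  "integral\<^sup>L lborel (\<lambda>x. indicator (cell z) x * K0 x) = integral\<^sup>L lborel (\<lambda>a. indicator (cell 0) a * K0 (z + a))"
  using lborel_integral_affine[of "\<lambda>x. indicator (cell z) x * K0 x" 1 z]
  by (simp add: indicator_def translate_in_cell_iff)

lemma near_region_integral:
  assumes "\<gamma> > - real CARD('n)"
  shows "\<bar>integral\<^sup>L lborel (\<lambda>x. indicator near_region x * K0 x)\<bar>
    \<le> C * integral\<^sup>L lborel (\<lambda>u :: real ^ 'n. indicator (cball 0 (2 * real CARD('n))) u * norm u powr \<gamma>)"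
proof -
  let ?R = "2 * real CARD('n)"
  let ?g = "\<lambda>x. indicator (cball \<alpha> ?R) x * norm (x - \<alpha>) powr \<gamma>"
  have R: "?R > 0" by simp
  note maj = integrable_near_majorant[OF assms R]
  have "near_region \<subseteq> cball \<alpha> ?R"
  proof
    fix x assume "x \<in> near_region"
    then obtain z where z: "z \<in> near_vectors" "x \<in> cell z" by (auto simp: near_region_def)
    have "\<bar>(\<alpha> - x) $ i\<bar> \<le> 2" for i
      using z \<alpha>[of i] by (auto simp: near_vectors_def cell_def abs_le_iff dest!: spec[of _ i])
    from norm_le_card_cart[OF this] show "x \<in> cball \<alpha> ?R" by (simp add: dist_norm mult.commute)
  qed
  then have le: "norm (indicator near_region x * K0 x) \<le> C * ?g x" for x
    using K0_bound[of x] C by (auto simp: indicator_def)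
  have int: "integrable lborel (\<lambda>x. indicator near_region x * K0 x)"
    using integrable_real_mult_indicator[OF _ integrable_K0[OF assms], of near_region]
    by (simp add: mult.commute)
  have "norm (integral\<^sup>L lborel (\<lambda>x. indicator near_region x * K0 x))
      \<le> integral\<^sup>L lborel (\<lambda>x. norm (indicator near_region x * K0 x))"
    by (rule integral_norm_bound)
  also have "\<dots> \<le> integral\<^sup>L lborel (\<lambda>x. C * ?g x)"
    by (rule integral_mono[OF integrable_norm[OF int] integrable_mult_right[OF maj(1)] le])
  finally show ?thesis by (simp add: maj(2))
qed

text \<open>
  Translating all cells to the unit cell around the origin shows that the first sum is the mean of
  \<open>far_sum\<close> over this cell; the second is its value at the centre.
\<close>

lemma far_quadrature_error:
  assumes "\<gamma> > - real CARD('n)"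
  shows "\<bar>(\<Sum>z\<in>relevant. integral\<^sup>L lborel (\<lambda>x. indicator (cell z) x * K0 x)) - (\<Sum>z\<in>relevant. K0 z)\<bar>
    \<le> real CARD('n) * step_bound"
proof -
  let ?I = "indicator (cell (0 :: real ^ 'n)) :: _ \<Rightarrow> real"
  let ?M = "real CARD('n) * step_bound"
  have int: "integrable lborel (\<lambda>a. ?I a * K0 (z + a))" for z
    using integrable_real_mult_indicator[OF _ lborel_integrable_translate[OF integrable_K0[OF assms]], of "cell 0" z]
    by (simp add: mult.commute)
  have intI: "integrable lborel (\<lambda>a. ?I a * c)" for c :: real
    by (intro integrable_mult_left integrable_real_indicator) (simp_all add: measure_cell_0)
  have one: "integral\<^sup>L lborel (\<lambda>a. ?I a * c) = c" for c :: real
    by (simp add: measure_def measure_cell_0)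
  have "(\<Sum>z\<in>relevant. integral\<^sup>L lborel (\<lambda>x. indicator (cell z) x * K0 x)) - (\<Sum>z\<in>relevant. K0 z)
      = (\<Sum>z\<in>relevant. integral\<^sup>L lborel (\<lambda>a. ?I a * K0 (z + a))) - integral\<^sup>L lborel (\<lambda>a. ?I a * far_sum 0)"
    by (simp only: integral_cell one) (simp add: far_sum_def)
  also have "\<dots> = integral\<^sup>L lborel (\<lambda>a. (\<Sum>z\<in>relevant. ?I a * K0 (z + a)) - ?I a * far_sum 0)"
    using int intI by (simp add: Bochner_Integration.integral_sum Bochner_Integration.integral_diff)
  also have "(\<lambda>a. (\<Sum>z\<in>relevant. ?I a * K0 (z + a)) - ?I a * far_sum 0) = (\<lambda>a. ?I a * (far_sum a - far_sum 0))"
    by (simp add: far_sum_def sum_distrib_left right_diff_distrib)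
  also have "\<bar>integral\<^sup>L lborel (\<lambda>a. ?I a * (far_sum a - far_sum 0))\<bar> \<le> integral\<^sup>L lborel (\<lambda>a. \<bar>?I a * (far_sum a - far_sum 0)\<bar>)"
    by (rule integral_abs_bound)
  also have "\<dots> \<le> integral\<^sup>L lborel (\<lambda>a. ?I a * ?M)"
  proof (rule integral_mono)
    have "integrable lborel (\<lambda>a. (\<Sum>z\<in>relevant. ?I a * K0 (z + a)) - ?I a * far_sum 0)"
      using int intI by (intro Bochner_Integration.integrable_diff Bochner_Integration.integrable_sum)
    then show "integrable lborel (\<lambda>a. \<bar>?I a * (far_sum a - far_sum 0)\<bar>)"
      by (intro integrable_abs) (simp add: far_sum_def sum_distrib_left right_diff_distrib)
    show "\<bar>?I a * (far_sum a - far_sum 0)\<bar> \<le> ?I a * ?M" for a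
      using far_sum_oscillation[of a 0] in_cell_0D[of a] by (auto simp: indicator_def)
  qed (rule intI)
  finally show ?thesis by (simp only: one)
qed

text \<open>
  A nonzero lattice point keeps a distance of at least one half from \<open>\<alpha>\<close>.
\<close>

lemma near_sum_bound:
  "\<bar>\<Sum>z\<in>near_vectors - {0}. K0 z\<bar> \<le> real (card (near_vectors :: (real ^ 'n) set)) * (C * (2 * real CARD('n)) powr \<bar>\<gamma>\<bar>)"
proof -
  let ?c = "C * (2 * real CARD('n)) powr \<bar>\<gamma>\<bar>"
  have "\<bar>\<Sum>z\<in>near_vectors - {0}. K0 z\<bar> \<le> (\<Sum>z\<in>near_vectors - {0}. \<bar>K0 z\<bar>)" by (rule sum_abs)
  also have "\<dots> \<le> (\<Sum>z\<in>near_vectors - {0 :: real ^ 'n}. ?c)"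
  proof (rule sum_mono)
    fix z :: "real ^ 'n" assume z: "z \<in> near_vectors - {0}"
    then obtain i where i: "z $ i \<noteq> 0" by (auto simp: vec_eq_iff)
    have "z $ i \<in> \<int>" using z by (auto simp: near_vectors_def integer_vectors_def)
    with i have "\<bar>z $ i\<bar> \<ge> 1" using Ints_nonzero_abs_ge1 by blast
    then have "\<bar>(z - \<alpha>) $ i\<bar> \<ge> 1 / 2"
      using \<alpha>[of i] unfolding vector_minus_component by linarith
    then have 1: "norm (z - \<alpha>) \<ge> 1 / 2" using component_le_norm_cart[of "z - \<alpha>" i] by linarith
    have "\<bar>(z - \<alpha>) $ m\<bar> \<le> 2" for m
      using z \<alpha>[of m] by (auto simp: near_vectors_def abs_le_iff dest!: spec[of _ m])
    from norm_le_card_cart[OF this] have 2: "norm (z - \<alpha>) \<le> 2 * real CARD('n)" by (simp add: mult.commute)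
    have "norm (z - \<alpha>) powr \<gamma> \<le> (2 * real CARD('n)) powr \<bar>\<gamma>\<bar>"
    proof (cases "\<gamma> \<ge> 0")
      case True
      then show ?thesis using 2 by (auto intro: powr_mono2)
    next
      case False
      have "norm (z - \<alpha>) powr \<gamma> \<le> (1 / 2) powr \<gamma>" using False 1 by (intro powr_mono2') auto
      also have "\<dots> = 2 powr \<bar>\<gamma>\<bar>" using False by (simp add: powr_divide powr_minus field_simps)
      also have "\<dots> \<le> (2 * real CARD('n)) powr \<bar>\<gamma>\<bar>"
        by (intro powr_mono2) (auto simp: Suc_le_eq)
      finally show ?thesis .
    qed
    from mult_left_mono[OF this, of C] K0_bound[of z] C
    show "\<bar>K0 z\<bar> \<le> ?c" by (meson less_imp_le order_trans)
  qed
  also have "\<dots> = real (card (near_vectors - {0} :: (real ^ 'n) set)) * ?c" by simp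
  also have "\<dots> \<le> real (card (near_vectors :: (real ^ 'n) set)) * ?c"
    using C by (intro mult_right_mono of_nat_mono card_mono finite_near_vectors) auto
  finally show ?thesis .
qed

definition error_bound :: real
  where "error_bound =
    C * integral\<^sup>L lborel (\<lambda>u :: real ^ 'n. indicator (cball 0 (2 * real CARD('n))) u * norm u powr \<gamma>)
    + real (card (near_vectors :: (real ^ 'n) set)) * (C * (2 * real CARD('n)) powr \<bar>\<gamma>\<bar>)
    + real CARD('n) * step_bound"

text \<open>
  The bound depends on the kernel only through the dimension, \<open>\<gamma>\<close>, \<open>C\<close> and \<open>k\<close>, not on \<open>\<alpha>\<close> and the
  radius \<open>\<rho>\<close> of the support.
\<close>

lemma punctured_quadrature_error:
  assumes "\<gamma> > - real CARD('n)"
  shows "\<bar>integral\<^sup>L lborel K0 - (\<Sum>\<^sub>\<infinity>z\<in>integer_vectors - {0}. K0 z)\<bar> \<le> error_bound"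
proof -
  have 0: "K0 z = 0" if "z \<in> integer_vectors - near_vectors - relevant" for z
    using K0_far_eq_0[OF that, of 0] by simp
  have z0: "0 \<in> near_vectors" by (simp add: near_vectors_def integer_vectors_def)
  have "(\<Sum>\<^sub>\<infinity>z\<in>integer_vectors - {0}. K0 z) = (\<Sum>\<^sub>\<infinity>z\<in>(near_vectors - {0}) \<union> relevant. K0 z)"
  proof (rule infsum_cong_neutral)
    show "K0 z = 0" if "z \<in> integer_vectors - {0} - (near_vectors - {0} \<union> relevant)" for z
      using that by (intro 0) auto
    show "K0 z = 0" if "z \<in> (near_vectors - {0} \<union> relevant) - (integer_vectors - {0})" for z
      using that z0 by (auto simp: near_vectors_def relevant_def)
  qed simp
  also have "\<dots> = (\<Sum>z\<in>(near_vectors - {0}) \<union> relevant. K0 z)"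
    using finite_near_vectors finite_relevant by (intro infsum_finite) auto
  also have "\<dots> = (\<Sum>z\<in>near_vectors - {0}. K0 z) + (\<Sum>z\<in>relevant. K0 z)"
    using finite_near_vectors finite_relevant by (intro sum.union_disjoint) (auto simp: relevant_def)
  finally have T: "(\<Sum>\<^sub>\<infinity>z\<in>integer_vectors - {0}. K0 z) = (\<Sum>z\<in>near_vectors - {0}. K0 z) + (\<Sum>z\<in>relevant. K0 z)" .
  have int: "integrable lborel (\<lambda>x. indicator A x * K0 x)" if "A \<in> sets borel" for A
    using integrable_real_mult_indicator[OF _ integrable_K0[OF assms], of A] that
    by (simp add: mult.commute)
  have "integral\<^sup>L lborel K0 = integral\<^sup>L lborel (\<lambda>x. indicator near_region x * K0 x + (\<Sum>z\<in>relevant. indicator (cell z) x * K0 x))"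
    using cell_decomposition by presburger
  also have "\<dots> = integral\<^sup>L lborel (\<lambda>x. indicator near_region x * K0 x)
      + (\<Sum>z\<in>relevant. integral\<^sup>L lborel (\<lambda>x. indicator (cell z) x * K0 x))"
    using int by (simp add: Bochner_Integration.integral_add Bochner_Integration.integral_sum near_region_measurable cell_measurable)
  finally show ?thesis
    using T near_region_integral[OF assms] far_quadrature_error[OF assms] near_sum_bound
    unfolding error_bound_def by linarith
qed

end

section \<open>The error of the punctured trapezoidal rule\<close>

theorem theorem2p1:
  fixes L L' h0 \<gamma> :: real
    and v s :: "real ^ 'n \<Rightarrow> real"
    and l :: "real \<times> (real ^ 'n) \<Rightarrow> real"
  assumes "0 < L + 3 / 2 * h0 * sqrt (real CARD('n))"
    and "L + 3 / 2 * h0 * sqrt (real CARD('n)) < L'"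
    and "0 < h0" and "h0 \<le> 1"
    and "smooth_compact_support (ball 0 L) v"
    and "smooth_on (ball 0 L' - {0}) s"
    and "\<gamma> > - real CARD('n)"
    and "smooth_on_subset ({- L'<..<L'} \<times> sphere 0 1) l"
    and "bounded (l ` ({- L'<..<L'} \<times> sphere 0 1))"
    and "\<And>x. x \<in> ball 0 L' - {0} \<Longrightarrow> s x = norm x powr \<gamma> * l (norm x, x /\<^sub>R norm x)"
  shows "\<exists>C. \<forall>h \<alpha>. 0 < h \<and> h < h0 \<and> infnorm \<alpha> \<le> 1 / 2 \<longrightarrow>
    (let f = (\<lambda>x. s (x - h *\<^sub>R \<alpha>) * v x)
     in \<bar>integral\<^sup>L lborel f - punctured_trapezoidal h f\<bar> \<le> C * h powr (\<gamma> + real CARD('n)))"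
proof -
  note v = assms(5) and l = assms(8)
  \<comment> \<open>The shifts \<open>h \<alpha>\<close> have norm at most \<open>B / 2\<close>. The profile is considered on an open domain
    of shifts, hence the larger bound \<open>B\<close>.\<close>
  define B where "B = h0 * sqrt (real CARD('n))"
  have B: "B > 0" using assms(3) by (simp add: B_def)
  have LB: "L + B \<le> L'" and B': "B / 2 < B" using assms(2) B by (simp_all add: B_def)
  \<comment> \<open>The order of differentiation: large enough for the lattice sum of \<open>norm w powr (\<gamma> - k)\<close>.\<close>
  obtain m where "\<gamma> + 2 * real CARD('n) \<le> real m" using real_arch_simple by blast
  then obtain k :: nat where k: "1 \<le> k" "\<gamma> + 2 * real CARD('n) \<le> real k"
    by (intro that[of "Suc m"]) auto
  let ?H = "profile \<gamma> l v"
  note H = Ck_on_profile[OF v l LB, of k \<gamma>]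
  obtain C where C: "C > 0" and CK: "\<And>j b r u \<beta>. j \<le> k \<Longrightarrow> b \<in> Basis \<Longrightarrow> r \<ge> 0 \<Longrightarrow> u \<noteq> 0 \<Longrightarrow> norm \<beta> \<le> B / 2 \<Longrightarrow>
      \<bar>iter_dirderiv (0, b, 0) j ?H (r, u, \<beta>)\<bar> \<le> C * norm u powr (\<gamma> - real j)"
    using iter_dirderiv_profile_bound[OF v l LB B', of k \<gamma>] by blast
  have "\<bar>integral\<^sup>L lborel (\<lambda>x. s (x - h *\<^sub>R \<alpha>) * v x) - punctured_trapezoidal h (\<lambda>x. s (x - h *\<^sub>R \<alpha>) * v x)\<bar>
      \<le> singular_kernel.error_bound TYPE('n) \<gamma> C k * h powr (\<gamma> + real CARD('n))"
    if h: "0 < h" "h < h0" and inf: "infnorm \<alpha> \<le> 1 / 2" for h and \<alpha> :: "real ^ 'n"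
  proof -
    define \<beta> where "\<beta> = h *\<^sub>R \<alpha>"
    define f where "f x = s (x - \<beta>) * v x" for x
    define K0 where "K0 x = ?H (h, x - \<alpha>, \<beta>)" for x
    define K where "K i j x = iter_dirderiv (0, axis i 1, 0) j ?H (h, x - \<alpha>, \<beta>)" for i :: 'n and j x
    have \<alpha>: "\<bar>\<alpha> $ i\<bar> \<le> 1 / 2" for i using component_le_infnorm_cart[of \<alpha> i] inf by linarith
    have \<beta>: "norm \<beta> \<le> B / 2"
    proof -
      have "norm \<alpha> \<le> sqrt (real CARD('n)) * infnorm \<alpha>" using norm_le_infnorm[of \<alpha>] by simp
      also have "\<dots> \<le> sqrt (real CARD('n)) * (1 / 2)" by (rule mult_left_mono[OF inf]) simp
      finally have "norm \<alpha> \<le> sqrt (real CARD('n)) * (1 / 2)" .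
      then have "h * norm \<alpha> \<le> h0 * (sqrt (real CARD('n)) * (1 / 2))"
        using h by (intro mult_mono) auto
      then show ?thesis using h by (simp add: \<beta>_def B_def)
    qed
    have \<beta>B: "norm \<beta> < B" using \<beta> B' by simp
    have shift: "h *\<^sub>R (x - \<alpha>) + \<beta> = h *\<^sub>R x" for x by (simp add: \<beta>_def algebra_simps)
    have dom: "(h, x - \<alpha>, \<beta>) \<in> profile_domain B" if "x \<noteq> \<alpha>" for x
      using that \<beta>B by (simp add: profile_domain_def)
    interpret singular_kernel \<alpha> K K0 \<gamma> C "L / h" k
    proof
      show "K i 0 = K0" for i by (simp add: K_def K0_def fun_eq_iff)
      show K0\<alpha>: "K0 \<alpha> = 0" by (simp add: K0_def profile_def)
      have "continuous_on (- {\<alpha>}) K0"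
        unfolding K0_def
        by (rule continuous_on_compose2[OF Ck_on_continuous[OF H]])
          (auto intro!: continuous_intros dom)
      then have "(\<lambda>x. indicator (- {\<alpha>}) x *\<^sub>R K0 x) \<in> borel_measurable borel"
        by (intro borel_measurable_continuous_on_indicator) auto
      moreover have "(\<lambda>x. indicator (- {\<alpha>}) x *\<^sub>R K0 x) = K0"
        using K0\<alpha> by (auto simp: indicator_def fun_eq_iff)
      ultimately show "K0 \<in> borel_measurable borel" by simp
      show "((\<lambda>t. K i j (y + t *\<^sub>R axis i 1)) has_real_derivative K i (Suc j) (y + t *\<^sub>R axis i 1)) (at t)"
        if "j < k" "y + t *\<^sub>R axis i 1 \<noteq> \<alpha>" for i j y t
      proof -
        have eq: "(h, y + t *\<^sub>R axis i 1 - \<alpha>, \<beta>) = (h, y - \<alpha>, \<beta>) + t *\<^sub>R (0, axis i 1, 0)" for t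
          by (simp add: algebra_simps)
        show ?thesis
          unfolding K_def eq
          by (rule iter_dirderiv_line[OF H that(1)]) (use dom[OF that(2)] in \<open>simp only: eq\<close>)
      qed
      show "\<bar>K i j x\<bar> \<le> C * norm (x - \<alpha>) powr (\<gamma> - real j)" if "j \<le> k" "x \<noteq> \<alpha>" for i j x
        unfolding K_def by (rule CK) (use that h \<beta> in \<open>auto simp: axis_in_Basis_iff\<close>)
      show "K i j x = 0" if "norm x > L / h" for i j x
        unfolding K_def
        by (rule iter_dirderiv_profile_eq_0[OF v]) (use that h in \<open>simp add: shift pos_divide_less_eq mult.commute\<close>)
    qed (use \<alpha> k C in auto)
    \<comment> \<open>Where \<open>v\<close> does not vanish, \<open>h *\<^sub>R y - \<beta>\<close> lies in the ball of radius \<open>L'\<close>, on which the form of \<open>s\<close> is known.\<close>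
    have fK: "f (h *\<^sub>R y) = h powr \<gamma> * K0 y" if "y \<noteq> \<alpha>" for y
    proof (cases "norm (h *\<^sub>R y) \<ge> L")
      case True
      then show ?thesis
        using smooth_compact_support_eq_0[OF v True] profile_eq_0[OF v, of h "y - \<alpha>" \<beta>]
        by (simp add: f_def K0_def shift)
    next
      case False
      have d: "h *\<^sub>R y - \<beta> = h *\<^sub>R (y - \<alpha>)" by (simp add: \<beta>_def algebra_simps)
      have "norm (h *\<^sub>R y - \<beta>) < L'"
        using norm_triangle_ineq4[of "h *\<^sub>R y" \<beta>] False \<beta>B LB by linarith
      then have "h *\<^sub>R (y - \<alpha>) \<in> ball 0 L' - {0}" using that h by (simp add: d)
      note s = assms(10)[OF this]
      have "s (h *\<^sub>R (y - \<alpha>)) = h powr \<gamma> * (norm (y - \<alpha>) powr \<gamma> * l (h * norm (y - \<alpha>), (y - \<alpha>) /\<^sub>R norm (y - \<alpha>)))"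
      proof -
        have "norm (h *\<^sub>R (y - \<alpha>)) = h * norm (y - \<alpha>)"
          "(h *\<^sub>R (y - \<alpha>)) /\<^sub>R norm (h *\<^sub>R (y - \<alpha>)) = (y - \<alpha>) /\<^sub>R norm (y - \<alpha>)"
          "(h * norm (y - \<alpha>)) powr \<gamma> = h powr \<gamma> * norm (y - \<alpha>) powr \<gamma>"
          using h by (simp_all add: powr_mult)
        then show ?thesis using s by (simp only: mult.assoc)
      qed
      then show ?thesis unfolding f_def d K0_def profile_def by (simp add: shift)
    qed
    have "integral\<^sup>L lborel f = h powr (\<gamma> + real CARD('n)) * integral\<^sup>L lborel K0"
    proof -
      have "f = (\<lambda>x. if x = \<beta> then f \<beta> else h powr \<gamma> * K0 (x /\<^sub>R h))"
      proof
        fix x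
        show "f x = (if x = \<beta> then f \<beta> else h powr \<gamma> * K0 (x /\<^sub>R h))"
        proof (cases "x = \<beta>")
          case False
          have x: "h *\<^sub>R (x /\<^sub>R h) = x" using h by simp
          then have "x /\<^sub>R h \<noteq> \<alpha>" using False by (auto simp: \<beta>_def)
          from fK[OF this] False show ?thesis by (simp only: x if_False)
        qed simp
      qed
      moreover have "(\<lambda>x. if x = \<beta> then f \<beta> else h powr \<gamma> * K0 (x /\<^sub>R h)) \<in> borel_measurable borel"
        by measurable
      ultimately have f: "f \<in> borel_measurable borel" by simp
      have "integral\<^sup>L lborel f = h ^ CARD('n) * integral\<^sup>L lborel (\<lambda>x. f (h *\<^sub>R x))"
        using lborel_integral_affine[OF f h(1), of 0] by simp
      also have "integral\<^sup>L lborel (\<lambda>x. f (h *\<^sub>R x)) = integral\<^sup>L lborel (\<lambda>x. h powr \<gamma> * K0 x)"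
      proof (rule integral_cong_AE)
        show "AE x in lborel. f (h *\<^sub>R x) = h powr \<gamma> * K0 x"
          using AE_lborel_singleton[of \<alpha>] by eventually_elim (rule fK)
      qed (use f in measurable)
      finally show ?thesis using h by (simp add: powr_add powr_realpow mult_ac)
    qed
    moreover have "punctured_trapezoidal h f
      = h powr (\<gamma> + real CARD('n)) * (\<Sum>\<^sub>\<infinity>z\<in>integer_vectors - {0}. K0 z)"
    proof -
      have lat: "scaled_integer_lattice h - {0} = (\<lambda>z. h *\<^sub>R z) ` (integer_vectors - {0 :: real ^ 'n})"
        using h by (auto simp: scaled_integer_lattice_def integer_vectors_def)
      have "(\<Sum>\<^sub>\<infinity>y\<in>scaled_integer_lattice h - {0}. f y) = (\<Sum>\<^sub>\<infinity>z\<in>integer_vectors - {0}. f (h *\<^sub>R z))"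
        unfolding lat using h by (subst infsum_reindex) (auto simp: inj_on_def o_def)
      also have "\<dots> = (\<Sum>\<^sub>\<infinity>z\<in>integer_vectors - {0}. h powr \<gamma> * K0 z)"
      proof (rule infsum_cong, rule fK)
        fix z :: "real ^ 'n" assume z: "z \<in> integer_vectors - {0}"
        then obtain i where i: "z $ i \<noteq> 0" by (auto simp: vec_eq_iff)
        have "z $ i \<in> \<int>" using z by (simp add: integer_vectors_def)
        with i have "\<bar>z $ i\<bar> \<ge> 1" using Ints_nonzero_abs_ge1 by blast
        then show "z \<noteq> \<alpha>" using \<alpha>[of i] by auto
      qed
      also have "\<dots> = h powr \<gamma> * (\<Sum>\<^sub>\<infinity>z\<in>integer_vectors - {0}. K0 z)" by (rule infsum_cmult_right')
      finally show ?thesis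
        using h by (simp add: punctured_trapezoidal_def powr_add powr_realpow mult_ac)
    qed
    ultimately have "integral\<^sup>L lborel f - punctured_trapezoidal h f
      = h powr (\<gamma> + real CARD('n)) * (integral\<^sup>L lborel K0 - (\<Sum>\<^sub>\<infinity>z\<in>integer_vectors - {0}. K0 z))"
      by (simp add: right_diff_distrib)
    also have "\<bar>\<dots>\<bar> \<le> h powr (\<gamma> + real CARD('n)) * error_bound"
      unfolding abs_mult using punctured_quadrature_error[OF assms(7)] by (intro mult_mono) auto
    finally have "\<bar>integral\<^sup>L lborel f - punctured_trapezoidal h f\<bar> \<le> error_bound * h powr (\<gamma> + real CARD('n))"
      by (simp only: mult.commute)
    moreover have "f = (\<lambda>x. s (x - h *\<^sub>R \<alpha>) * v x)" by (simp add: fun_eq_iff f_def \<beta>_def)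
    ultimately show ?thesis by simp
  qed
  then show ?thesis by (auto simp: Let_def)
qed

end
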